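(* Let $n\ge 1$, $1\le s\le n$, let $A_1,\dots,A_s\subset\mathbb Z^n$ be finite sets and let $m_1,\dots,m_s\ge 0$ be integers with $m_1+\cdots+m_s=n$. Assume that the mixed volume satisfies $V(\mathrm{conv}(A_1),m_1;\dots;\mathrm{conv}(A_s),m_s)\ge 1$. Let $b:A_1\sqcup\cdots\sqcup A_s\to\mathbb R$ be a lifting in general position, let $F_0\subset F_1\subset\cdots\subset F_n=\mathbb R^n$ be a generic affine flag, and let $(m_i(d))_{d=0,\dots,n}$, $i=1,\dots,s$, be sequences as described in the context. Then: (a) each set $X'_d$, $d=1,\dots,n$, is a finite closed union of line segments and half-lines; (b) $X_{d-1}=X'_d\cap F_{d-1}$ for $d=1,\dots,n$; (c) each connected component of $X'_d$ meets $F_{d-1}$ at least once; (d) (transversality) every point of $X'_d\cap F_{d-1}$ lies in the interior of a line segment or of a half-line contained in $X'_d$.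
   Context: For convex bodies $K_1,\dots,K_s\subset\mathbb R^n$ and nonnegative integers $m_1+\cdots+m_s=n$, $V(K_1,m_1;\dots;K_s,m_s)$ denotes the mixed volume $V(K_1,\dots,K_1,\dots,K_s,\dots,K_s)$ with $K_i$ repeated $m_i$ times, where the mixed volume of an $n$-tuple $(\mathcal K_1,\dots,\mathcal K_n)$ is $\frac{1}{n!}\frac{\partial^n}{\partial t_1\cdots\partial t_n}\mathrm{Vol}(t_1\mathcal K_1+\cdots+t_n\mathcal K_n)$ (at $t=0$, $t_i\ge0$). A lifting is a function $b:A_1\sqcup\cdots\sqcup A_s\to\mathbb R$, written $b(i,\mathbf a)$ for $\mathbf a\in A_i$. It is in general position if for every subset $S$ of $\{[-\mathrm e_i,\mathbf a,b(i,\mathbf a)]:1\le i\le s,\ \mathbf a\in A_i\}\subset\mathbb R^s\times\mathbb R^n\times\mathbb R$ of cardinality at most $n+s+1$, either the vectors of $S$ are linearly independent or $[0,\dots,0,1]$ is a linear combination of them ($\mathrm e_i$ the $i$-th canonical basis vector of $\mathbb R^s$). For $\boldsymbol\xi\in(\mathbb R^n)^*$ set $\lambda_i(\boldsymbol\xi)=\max_{\mathbf a\in A_i}(\boldsymbol\xi(\mathbf a)-b(i,\mathbf a))$ and let $m_i(\boldsymbol\xi)$ be such that this maximum is attained at exactly $m_i(\boldsymbol\xi)+1$ points $\mathbf a\in A_i$. The flag $F_0\subset\cdots\subset F_n$ consists of affine subspaces with $\dim F_d=d$. For each $i$, $(m_i(d))_{d=0,\dots,n}$ is a non-decreasing sequence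 of nonnegative integers with $m_i(0)=0$, $m_i(n)=m_i$, and $\sum_i m_i(d)=d$ for every $d$. Define $X_d=\{\boldsymbol\xi\in F_d: m_i(\boldsymbol\xi)\ge m_i(d)\ \forall i\}$ and $X'_d=\{\boldsymbol\xi\in F_d: m_i(\boldsymbol\xi)\ge m_i(d-1)\ \forall i\}$. *)

theory Defs
  imports "HOL-Analysis.Analysis"
begin

definition minkowski_comb :: "(nat \<Rightarrow> real) \<Rightarrow> ('a::real_vector) set list \<Rightarrow> 'a set" where
  "minkowski_comb t Ks =
     {(\<Sum>i<length Ks. t i *\<^sub>R x i) | x. \<forall>i<length Ks. x i \<in> Ks ! i}"

definition vol_fun :: "('a::euclidean_space) set list \<Rightarrow> (nat \<Rightarrow> real) \<Rightarrow> real" where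
  "vol_fun Ks t = measure lebesgue (minkowski_comb t Ks)"

text \<open>Partial derivative in the k-th variable, taken within the nonnegative half-line
  (so at t_k = 0 it is the one-sided derivative, as in the definition with t_i >= 0).\<close>
definition partial_nonneg :: "nat \<Rightarrow> ((nat \<Rightarrow> real) \<Rightarrow> real) \<Rightarrow> (nat \<Rightarrow> real) \<Rightarrow> real" where
  "partial_nonneg k g t = vector_derivative (\<lambda>h. g (t(k := h))) (at (t k) within {0..})"

fun iter_partial :: "nat \<Rightarrow> ((nat \<Rightarrow> real) \<Rightarrow> real) \<Rightarrow> (nat \<Rightarrow> real) \<Rightarrow> real" where
  "iter_partial 0 g = g"
| "iter_partial (Suc k) g = partial_nonneg k (iter_partial k g)"

definition mixed_volume :: "('a::euclidean_space) set list \<Rightarrow> real" where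
  "mixed_volume Ks = iter_partial (length Ks) (vol_fun Ks) (\<lambda>_. 0) / fact (length Ks)"

definition mixed_volume_mult :: "(nat \<Rightarrow> ('a::euclidean_space) set) \<Rightarrow> (nat \<Rightarrow> nat) \<Rightarrow> nat \<Rightarrow> real" where
  "mixed_volume_mult K m s = mixed_volume (concat (map (\<lambda>i. replicate (m i) (K i)) [0..<s]))"

definition idx :: "nat \<Rightarrow> 'n::finite" where
  "idx = (SOME f. bij_betw f {..<CARD('n)} (UNIV :: 'n set))"

definition flag :: "real^'n \<Rightarrow> real^'n^'n \<Rightarrow> nat \<Rightarrow> (real^'n) set" where
  "flag p M d = (\<lambda>x. p + x) ` span {M $ idx j | j. j < d}"

text \<open>The vectors [-e_i, a, b(i,a)]; R^s is embedded in R^n (s <= n) via e_i = axis (idx i) 1.\<close>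
definition lift_vecs :: "(nat \<Rightarrow> (real^'n) set) \<Rightarrow> (nat \<Rightarrow> real^'n \<Rightarrow> real) \<Rightarrow> nat
    \<Rightarrow> ((real^'n) \<times> (real^'n) \<times> real) set" where
  "lift_vecs A b s = {(- axis (idx i) 1, a, b i a) | i a. i < s \<and> a \<in> A i}"

definition lifting_general_position ::
    "(nat \<Rightarrow> (real^'n) set) \<Rightarrow> (nat \<Rightarrow> real^'n \<Rightarrow> real) \<Rightarrow> nat \<Rightarrow> bool" where
  "lifting_general_position A b s \<longleftrightarrow>
     (\<forall>S. S \<subseteq> lift_vecs A b s \<and> card S \<le> CARD('n) + s + 1 \<longrightarrow>
        independent S \<or> (0, 0, 1) \<in> span S)"

definition top_pts :: "(nat \<Rightarrow> (real^'n) set) \<Rightarrow> (nat \<Rightarrow> real^'n \<Rightarrow> real) \<Rightarrow> nat \<Rightarrow> real^'n \<Rightarrow> (real^'n) set" where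
  "top_pts A b i \<xi> = {a \<in> A i. \<forall>a' \<in> A i. \<xi> \<bullet> a' - b i a' \<le> \<xi> \<bullet> a - b i a}"

definition mult_at :: "(nat \<Rightarrow> (real^'n) set) \<Rightarrow> (nat \<Rightarrow> real^'n \<Rightarrow> real) \<Rightarrow> nat \<Rightarrow> real^'n \<Rightarrow> int" where
  "mult_at A b i \<xi> = int (card (top_pts A b i \<xi>)) - 1"

text \<open>{xi in F : m_i(xi) >= k_i for all i}.  X_d = Xset A b s (\<lambda>i. md i d) (F d),
  X'_d = Xset A b s (\<lambda>i. md i (d-1)) (F d).\<close>
definition Xset :: "(nat \<Rightarrow> (real^'n) set) \<Rightarrow> (nat \<Rightarrow> real^'n \<Rightarrow> real) \<Rightarrow> nat \<Rightarrow> (nat \<Rightarrow> nat)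
    \<Rightarrow> (real^'n) set \<Rightarrow> (real^'n) set" where
  "Xset A b s k F = {\<xi> \<in> F. \<forall>i<s. int (k i) \<le> mult_at A b i \<xi>}"

definition halfline :: "'a::real_vector \<Rightarrow> 'a \<Rightarrow> 'a set" where
  "halfline x v = {x + t *\<^sub>R v | t. 0 \<le> t}"

definition seg_or_halfline :: "'a::real_vector set \<Rightarrow> bool" where
  "seg_or_halfline L \<longleftrightarrow>
     (\<exists>x y. x \<noteq> y \<and> L = closed_segment x y) \<or> (\<exists>x v. v \<noteq> 0 \<and> L = halfline x v)"

end

theory Submission
  imports Defs
begin

text \<open>At a point \<open>\<xi>\<close> the pairs \<open>(i, a)\<close> with \<open>a\<close> maximal for \<open>\<lambda>_i\<close> form an independent system of
  ties, because \<open>(\<lambda>(\<xi>), \<xi>, -1)\<close> annihilates their lifted vectors but not \<open>(0, 0, 1)\<close>. For a generic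
  flag these ties stay independent on the direction space of every \<open>F_d\<close>, so that a point of \<open>F_d\<close>
  has at most \<open>s + d\<close> of them. The set \<open>X'_d\<close> is a finite union of closed convex pieces, one for each
  system of \<open>s + d - 1\<close> ties; a piece lies in a line and can be continued from each of its points.
  On a component \<open>C\<close> of \<open>X'_d\<close> that misses \<open>F_{d-1}\<close> a functional \<open>u\<close> that vanishes on the direction
  space of \<open>F_{d-1}\<close> is bounded below up to sign, hence attains its minimum. This is impossible:
  at a point with \<open>s + d\<close> ties \<open>u\<close> is a combination of the ties whose coefficients add up to 0 over
  each colour, so some tie has a positive coefficient, and dropping that tie gives a direction
  along which \<open>u\<close> decreases.\<close>

section \<open>Linear systems with real coefficients\<close>

text \<open>Genericity is a finite list of conditions on \<open>(p, M)\<close>, each saying that a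
  square matrix with entries polynomial in \<open>(p, M)\<close> is nonsingular. Such a condition
  holds on an open set with negligible complement once a single pair satisfies it, and such a pair
  is built row by row. This construction needs ties that are affinely independent in the whole
  space, and that is what the general position of the lifting supplies. All counts come from the tie
  matrix, which has one unknown for the common value of each of the \<open>s\<close> colours and one
  for each of the \<open>d\<close> directions of \<open>F_d\<close>. A choice of
  \<open>k_i + 1\<close> ties of each colour, where the \<open>k_i\<close> add up to
  \<open>d - 1\<close>, consists of \<open>s + d - 1\<close> ties, one short of a square system: one
  direction remains free in \<open>F_d\<close>, while none is left in
  \<open>F_{d-1}\<close>.\<close>

definition row_indep :: "'t set \<Rightarrow> 'k set \<Rightarrow> ('t \<Rightarrow> 'k \<Rightarrow> real) \<Rightarrow> bool" where
  "row_indep T J f \<longleftrightarrow> (\<forall>c. (\<forall>k\<in>J. (\<Sum>t\<in>T. c t * f t k) = 0) \<longrightarrow> (\<forall>t\<in>T. c t = 0))"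

lemma row_indepD:
  assumes "row_indep T J f" "\<And>k. k \<in> J \<Longrightarrow> (\<Sum>t\<in>T. c t * f t k) = 0" "t \<in> T"
  shows "c t = 0"
  using assms unfolding row_indep_def by blast

lemma not_row_indepE:
  assumes "\<not> row_indep T J f"
  obtains c t where "\<And>k. k \<in> J \<Longrightarrow> (\<Sum>t\<in>T. c t * f t k) = 0" "t \<in> T" "c t \<noteq> 0"
  using assms unfolding row_indep_def by blast

lemma row_indep_cong:
  assumes "\<And>t k. t \<in> T \<Longrightarrow> k \<in> J \<Longrightarrow> f t k = g t k"
  shows "row_indep T J f \<longleftrightarrow> row_indep T J g"
  unfolding row_indep_def using assms by (simp cong: sum.cong)

text \<open>A step of Gaussian elimination without division, so that entries polynomial in a
  parameter stay polynomial.\<close>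

lemma row_indep_pivot:
  assumes T: "finite T" "t0 \<in> T" and k0: "k0 \<in> J" and nz: "f t0 k0 \<noteq> 0"
  shows "row_indep T J f \<longleftrightarrow>
    row_indep (T - {t0}) (J - {k0}) (\<lambda>t k. f t k * f t0 k0 - f t k0 * f t0 k)"
proof
  assume ind: "row_indep T J f"
  show "row_indep (T - {t0}) (J - {k0}) (\<lambda>t k. f t k * f t0 k0 - f t k0 * f t0 k)"
    unfolding row_indep_def
  proof (intro allI impI ballI)
    fix c t
    assume c: "\<forall>k\<in>J - {k0}. (\<Sum>t\<in>T - {t0}. c t * (f t k * f t0 k0 - f t k0 * f t0 k)) = 0"
      and t: "t \<in> T - {t0}"
    \<comment> \<open>The coefficient of the pivot row is chosen to cancel column
      \<open>k0\<close>.\<close>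
    define C where "C = (\<lambda>t. if t = t0 then - (\<Sum>t\<in>T - {t0}. c t * f t k0) else c t * f t0 k0)"
    have sumC: "(\<Sum>t\<in>T. C t * f t k) = (\<Sum>t\<in>T - {t0}. c t * (f t k * f t0 k0 - f t k0 * f t0 k))" for k
    proof -
      have "(\<Sum>t\<in>T. C t * f t k)
          = - (\<Sum>t\<in>T - {t0}. c t * f t k0) * f t0 k + (\<Sum>t\<in>T - {t0}. c t * f t0 k0 * f t k)"
        using T by (simp add: sum.remove[of T t0] C_def)
      then show ?thesis
        by (simp add: sum_distrib_right sum_distrib_left sum_subtractf right_diff_distrib mult_ac)
    qed
    have "(\<Sum>t\<in>T. C t * f t k) = 0" if "k \<in> J" for k
      using c that by (cases "k = k0") (auto simp: sumC algebra_simps)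
    then have "C t = 0"
      using row_indepD[OF ind] t by blast
    then show "c t = 0"
      using t nz by (auto simp: C_def)
  qed
next
  assume ind: "row_indep (T - {t0}) (J - {k0}) (\<lambda>t k. f t k * f t0 k0 - f t k0 * f t0 k)"
  show "row_indep T J f"
    unfolding row_indep_def
  proof (intro allI impI)
    fix c
    assume c: "\<forall>k\<in>J. (\<Sum>t\<in>T. c t * f t k) = 0"
    have rest: "(\<Sum>t\<in>T - {t0}. c t * f t k) = - c t0 * f t0 k" if "k \<in> J" for k
      using c that T by (simp add: sum.remove[of T t0] add_eq_0_iff)
    have "(\<Sum>t\<in>T - {t0}. c t * (f t k * f t0 k0 - f t k0 * f t0 k)) = 0" if "k \<in> J - {k0}" for k
    proof -
      have "(\<Sum>t\<in>T - {t0}. c t * (f t k * f t0 k0 - f t k0 * f t0 k))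
          = (\<Sum>t\<in>T - {t0}. c t * f t k) * f t0 k0 - (\<Sum>t\<in>T - {t0}. c t * f t k0) * f t0 k"
        by (simp add: sum_distrib_right sum_distrib_left sum_subtractf right_diff_distrib mult_ac)
      then show ?thesis
        using rest that k0 by simp
    qed
    then have z: "c t = 0" if "t \<in> T - {t0}" for t
      using row_indepD[OF ind] that by blast
    then have "c t0 * f t0 k0 = 0"
      using rest[OF k0] by simp
    then show "\<forall>t\<in>T. c t = 0"
      using z nz by fastforce
  qed
qed

lemma row_indep_nonzero_entry:
  assumes "row_indep T J f" "finite T" "t0 \<in> T"
  obtains k where "k \<in> J" "f t0 k \<noteq> 0"
proof (rule ccontr)
  assume "\<not> thesis"
  then have "\<And>k. k \<in> J \<Longrightarrow> f t0 k = 0"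
    using that by blast
  then have "(\<Sum>t\<in>T. (if t = t0 then 1 else 0) * f t k) = 0" if "k \<in> J" for k
    using that assms by (intro sum.neutral) auto
  from row_indepD[OF assms(1) this assms(3)] show False by simp
qed

lemma row_indep_card_le:
  assumes "finite T" "finite J" "row_indep T J f"
  shows "card T \<le> card J"
  using assms
proof (induction T arbitrary: J f rule: finite_induct)
  case (insert t0 T)
  obtain k where k: "k \<in> J" "f t0 k \<noteq> 0"
    using row_indep_nonzero_entry[OF insert.prems(2)] insert.hyps by auto
  have "row_indep T (J - {k}) (\<lambda>t l. f t l * f t0 k - f t k * f t0 l)"
    using row_indep_pivot[of "insert t0 T" t0 k J f] k insert by simp
  then have "card T \<le> card (J - {k})"
    using insert by blast
  then show ?case
    using insert k by (simp add: card_Diff_singleton_if card_gt_0_iff Suc_le_eq)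
      (metis card_gt_0_iff empty_iff Suc_pred le_imp_less_Suc)
qed auto

lemma homogeneous_nontrivial_solution:
  assumes "finite T" "finite J" "card T < card J"
  obtains w k where "k \<in> J" "w k \<noteq> 0" "\<And>t. t \<in> T \<Longrightarrow> (\<Sum>k\<in>J. w k * f t k) = (0::real)"
proof -
  have "\<not> row_indep J T (\<lambda>k t. f t k)"
    using row_indep_card_le[OF assms(2,1)] assms(3) by force
  then show thesis
    by (rule not_row_indepE) (rule that)
qed

text \<open>If a column relation involves column \<open>k0\<close>, the other columns are fewer than
  the rows, so some row relation annihilates them. It then annihilates column \<open>k0\<close> as
  well, against row independence.\<close>

lemma row_indep_square_transpose:
  assumes fin: "finite T" "finite J" and card: "card T = card J" and ind: "row_indep T J f"
  shows "row_indep J T (\<lambda>k t. f t k)"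
proof (rule ccontr)
  assume "\<not> row_indep J T (\<lambda>k t. f t k)"
  then obtain w k0 where w: "\<And>t. t \<in> T \<Longrightarrow> (\<Sum>k\<in>J. w k * f t k) = 0" and k0: "k0 \<in> J" "w k0 \<noteq> 0"
    by (rule not_row_indepE) blast
  have "card (J - {k0}) < card T"
    using k0 fin card by (metis card_Diff1_less)
  then obtain c t0 where t0: "t0 \<in> T" "c t0 \<noteq> 0"
    and c: "\<And>k. k \<in> J - {k0} \<Longrightarrow> (\<Sum>t\<in>T. c t * f t k) = 0"
    using homogeneous_nontrivial_solution[of "J - {k0}" T "\<lambda>k t. f t k"] fin
    by (metis finite_Diff)
  have "w k0 * (\<Sum>t\<in>T. c t * f t k0) = (\<Sum>k\<in>J. w k * (\<Sum>t\<in>T. c t * f t k))"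
    using c k0 fin by (simp add: sum.remove[of J k0])
  also have "\<dots> = (\<Sum>t\<in>T. c t * (\<Sum>k\<in>J. w k * f t k))"
    unfolding sum_distrib_left by (subst sum.swap) (simp add: ac_simps)
  also have "\<dots> = 0"
    using w by simp
  finally have "(\<Sum>t\<in>T. c t * f t k0) = 0"
    using k0 by simp
  then have "c t0 = 0"
    using row_indepD[OF ind, of c] c t0 by blast
  then show False
    using t0 by simp
qed

text \<open>Adjoining the right-hand side as a further row, indexed by \<open>None\<close>, gives
  more rows than columns. The resulting relation must involve the new row and is solved for
  it.\<close>

lemma row_indep_square_solve:
  assumes fin: "finite T" "finite J" and card: "card T = card J" and ind: "row_indep T J f"
  obtains c where "\<And>k. k \<in> J \<Longrightarrow> (\<Sum>t\<in>T. c t * f t k) = \<psi> k"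
proof -
  define T' where "T' = insert None (Some ` T)"
  define f' where "f' = (\<lambda>t. case t of None \<Rightarrow> \<psi> | Some t \<Rightarrow> f t)"
  have "card J < card T'" "finite T'"
    using fin card by (auto simp: T'_def card_image)
  then obtain c t0 where t0: "t0 \<in> T'" "c t0 \<noteq> 0"
    and c: "\<And>k. k \<in> J \<Longrightarrow> (\<Sum>t\<in>T'. c t * f' t k) = 0"
    using homogeneous_nontrivial_solution[of J T' "\<lambda>k t. f' t k"] fin by blast
  have eq: "c None * \<psi> k + (\<Sum>t\<in>T. c (Some t) * f t k) = 0" if "k \<in> J" for k
  proof -
    have "(\<Sum>t\<in>T'. c t * f' t k) = c None * f' None k + (\<Sum>t\<in>Some ` T. c t * f' t k)"
      unfolding T'_def using fin by (subst sum.insert) auto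
    then show ?thesis
      using c[OF that] by (simp add: sum.reindex f'_def)
  qed
  have "c None \<noteq> 0"
  proof
    assume 0: "c None = 0"
    then have "c (Some t) = 0" if "t \<in> T" for t
      using row_indepD[OF ind, of "\<lambda>t. c (Some t)"] eq that by simp
    then show False
      using t0 0 by (auto simp: T'_def)
  qed
  then have "(\<Sum>t\<in>T. (- c (Some t) / c None) * f t k) = \<psi> k" if "k \<in> J" for k
    using eq[OF that]
    by (simp add: sum_divide_distrib[symmetric] sum_negf field_simps)
  then show thesis by (rule that)
qed

section \<open>Generic points\<close>

text \<open>The certificate \<open>g\<close> is the product of the pivots met when eliminating at
  \<open>x0\<close>, read as functions of \<open>x\<close>; it takes the place of a nonvanishing
  minor.\<close>

lemma polynomial_generic_row_indep:
  fixes f :: "'a::real_normed_vector \<Rightarrow> 't \<Rightarrow> 'k \<Rightarrow> real"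
  assumes "finite T" "\<And>t k. t \<in> T \<Longrightarrow> k \<in> J \<Longrightarrow> real_polynomial_function (\<lambda>x. f x t k)"
    "row_indep T J (f x0)"
  shows "\<exists>g. real_polynomial_function g \<and> g x0 \<noteq> 0 \<and> (\<forall>x. g x \<noteq> 0 \<longrightarrow> row_indep T J (f x))"
  using assms
proof (induction T arbitrary: J f rule: finite_induct)
  case empty
  show ?case
    by (intro exI[of _ "\<lambda>_. 1"]) (auto simp: row_indep_def)
next
  case (insert t0 T)
  obtain k where k: "k \<in> J" "f x0 t0 k \<noteq> 0"
    using row_indep_nonzero_entry[OF insert.prems(2)] insert.hyps by auto
  define f' where "f' = (\<lambda>x t l. f x t l * f x t0 k - f x t k * f x t0 l)"
  have piv: "row_indep (insert t0 T) J (f x) \<longleftrightarrow> row_indep T (J - {k}) (f' x)"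
    if "f x t0 k \<noteq> 0" for x
    using row_indep_pivot[of "insert t0 T" t0 k J "f x"] that k insert.hyps by (simp add: f'_def)
  have "real_polynomial_function (\<lambda>x. f' x t l)" if "t \<in> T" "l \<in> J - {k}" for t l
    unfolding f'_def using that k
    by (intro real_polynomial_function_diff real_polynomial_function.intros(4) insert.prems) auto
  then obtain g where g: "real_polynomial_function g" "g x0 \<noteq> 0"
    "\<And>x. g x \<noteq> 0 \<Longrightarrow> row_indep T (J - {k}) (f' x)"
    using insert.IH[of "J - {k}" f'] piv[OF k(2)] insert.prems(2) by blast
  show ?case
    using g piv k insert.prems(1)
    by (intro exI[of _ "\<lambda>x. f x t0 k * g x"]) (auto intro!: real_polynomial_function.intros(4))
qed

text \<open>The dilates of a bounded part of \<open>S\<close> by the factors \<open>1 + 1 / k\<close> have at least its measure and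
  lie in a common ball, but each point lies in only finitely many of them.\<close>

lemma negligible_if_finite_on_rays:
  fixes S :: "'a::euclidean_space set"
  assumes S: "closed S" and ray: "\<And>x. finite {c. a + c *\<^sub>R x \<in> S}"
  shows "negligible S"
proof -
  have "negligible (S \<inter> cball a R)" for R
  proof -
    let ?K = "S \<inter> cball a R"
    define c where "c = (\<lambda>k. 1 + 1 / real (Suc k))"
    have c1: "1 < c k" "c k \<le> 2" for k
      by (auto simp: c_def)
    have injc: "inj c"
      by (auto simp: c_def inj_def)
    define D where "D = (\<lambda>k. (\<lambda>x. c k *\<^sub>R x + (1 - c k) *\<^sub>R a) ` ?K)"
    define B where "B = (\<lambda>m. \<Union>k\<in>{m..}. D k)"
    have K: "compact ?K"
      using S by (simp add: closed_Int_compact)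
    have D: "compact (D k)" for k
      unfolding D_def by (intro compact_continuous_image K continuous_intros)
    have D_eq: "x \<in> D k \<Longrightarrow> a + (1 / c k) *\<^sub>R (x - a) \<in> ?K" for x k
      using c1[of k] by (auto simp: D_def algebra_simps)
    have "D k \<subseteq> cball a (2 * R)" for k
    proof
      fix x assume "x \<in> D k"
      then have "norm (x - a) / c k \<le> R"
        using D_eq[of x k] c1[of k] by (simp add: dist_norm del: scaleR_right_diff_distrib)
      then have n: "norm (x - a) \<le> c k * R"
        using c1[of k] by (simp add: field_simps)
      then have "0 \<le> c k * R"
        using norm_ge_zero order_trans by blast
      then have "0 \<le> R"
        using c1[of k] by (simp add: zero_le_mult_iff)
      then have "c k * R \<le> 2 * R"
        using c1[of k] by (simp add: mult_right_mono)
      then show "x \<in> cball a (2 * R)"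
        using n by (simp add: dist_norm norm_minus_commute)
    qed
    then have B_sub: "B m \<subseteq> cball a (2 * R)" for m
      by (auto simp: B_def)
    have D_m: "D k \<in> sets lebesgue" for k
      using D by (simp add: lmeasurable_compact fmeasurableD)
    have B_m: "B m \<in> sets lebesgue" for m
      unfolding B_def by (rule sets.countable_UN') (use D_m in auto)
    have B_fin: "B m \<in> lmeasurable" for m
      by (rule fmeasurableI2[OF _ B_sub B_m]) simp
    have "(\<Inter>m. B m) = {}"
    proof (rule ccontr)
      assume "(\<Inter>m. B m) \<noteq> {}"
      then obtain x where "x \<in> (\<Inter>m. B m)"
        by blast
      then have x: "\<forall>m. \<exists>k\<in>{m..}. x \<in> D k"
        by (simp add: B_def)
      have "{k. x \<in> D k} \<subseteq> (\<lambda>k. 1 / c k) -` {t. a + t *\<^sub>R (x - a) \<in> S}"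
        using D_eq by auto
      moreover have "inj (\<lambda>k. 1 / c k)"
        using injc by (auto simp: inj_def)
      ultimately have "finite {k. x \<in> D k}"
        using ray[of "x - a"] by (meson finite_subset finite_vimageI)
      then show False
        using x by (meson atLeast_iff finite_nat_set_iff_bounded_le mem_Collect_eq not_less_eq_eq)
    qed
    moreover have "(\<lambda>m. measure lebesgue (B m)) \<longlonglongrightarrow> measure lebesgue (\<Inter>m. B m)"
    proof (rule Lim_measure_decseq)
      show "decseq B"
        by (force simp: decseq_def B_def)
      show "emeasure lebesgue (B i) \<noteq> \<infinity>" for i
        using fmeasurableD2[OF B_fin] by simp
    qed (use B_m in auto)
    ultimately have lim: "(\<lambda>m. measure lebesgue (B m)) \<longlonglongrightarrow> 0"
      by simp
    have "measure lebesgue ?K \<le> measure lebesgue (B m)" for m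
    proof -
      have "measure lebesgue ?K \<le> \<bar>c m\<bar> ^ DIM('a) * measure lebesgue ?K"
        using c1[of m] by (simp add: mult_le_cancel_right1 one_le_power less_imp_le)
      also have "\<dots> = measure lebesgue (D m)"
        unfolding D_def by (rule measure_lebesgue_affine[symmetric])
      also have "\<dots> \<le> measure lebesgue (B m)"
        by (rule measure_mono_fmeasurable) (use D_m B_fin in \<open>auto simp: B_def\<close>)
      finally show ?thesis .
    qed
    then have "measure lebesgue ?K \<le> 0"
      using lim by (meson LIMSEQ_le_const)
    then show ?thesis
      using K by (simp add: negligible_iff_measure lmeasurable_compact measure_le_0_iff)
  qed
  then have "negligible (\<Union>n::nat. S \<inter> cball a (real n))"
    by (intro negligible_countable_Union) auto
  moreover have "S = (\<Union>n::nat. S \<inter> cball a (real n))"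
    using real_arch_simple by auto
  ultimately show ?thesis
    by simp
qed

lemma real_polynomial_function_on_line:
  assumes "real_polynomial_function g"
  shows "real_polynomial_function (\<lambda>c. g (a + c *\<^sub>R x))"
  using assms
proof (induction rule: real_polynomial_function.induct)
  case (linear f)
  then interpret bounded_linear f .
  have "real_polynomial_function (\<lambda>c. f a + c * f x)"
    by (intro real_polynomial_function.intros bounded_linear_ident)
  then show ?case
    by (simp add: add scaleR)
qed auto

text \<open>With the rays centred at \<open>x0\<close>, the restriction of \<open>g\<close> to any
  ray is a one-variable polynomial with value \<open>g x0\<close>, hence nonzero, at 0, so it has
  finitely many roots.\<close>

lemma negligible_zeros_real_polynomial_function:
  fixes g :: "'a::euclidean_space \<Rightarrow> real"
  assumes g: "real_polynomial_function g" and x0: "g x0 \<noteq> 0"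
  shows "closed {x. g x = 0}" "negligible {x. g x = 0}"
proof -
  have "continuous_on UNIV g"
    using g continuous_on_polymonial_function real_polynomial_function_eq by blast
  then show closed: "closed {x. g x = 0}"
    using closed_Collect_eq[of g "\<lambda>_. 0"] by simp
  show "negligible {x. g x = 0}"
  proof (rule negligible_if_finite_on_rays[OF closed, of x0])
    fix x
    obtain p n where p: "(\<lambda>c. g (x0 + c *\<^sub>R x)) = (\<lambda>c. \<Sum>i\<le>n. p i * c ^ i)"
      using real_polynomial_function_imp_sum[OF real_polynomial_function_on_line[OF g]] by blast
    have "\<exists>k\<le>n. p k \<noteq> 0"
    proof (rule ccontr)
      assume "\<not> ?thesis"
      then have "(\<Sum>i\<le>n. p i * 0 ^ i) = 0"
        by (intro sum.neutral) auto
      then show False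
        using fun_cong[OF p, of 0] x0 by simp
    qed
    then have "finite {c. (\<Sum>i\<le>n. p i * c ^ i) = 0}"
      by (rule polyfun_rootbound_finite)
    then show "finite {c. x0 + c *\<^sub>R x \<in> {x. g x = 0}}"
      using fun_cong[OF p] by simp
  qed
qed

text \<open>An open set is kept, not just a null exceptional set, because the theorem asks for an
  open set of admissible flags.\<close>

definition generically :: "('a::euclidean_space \<Rightarrow> bool) \<Rightarrow> bool" where
  "generically P \<longleftrightarrow> (\<exists>U. open U \<and> negligible (- U) \<and> (\<forall>x\<in>U. P x))"

lemma generically_mono: "generically P \<Longrightarrow> (\<And>x. P x \<Longrightarrow> Q x) \<Longrightarrow> generically Q"
  unfolding generically_def by blast

lemma generically_conj:
  assumes "generically P" "generically Q"
  shows "generically (\<lambda>x. P x \<and> Q x)"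
proof -
  obtain U V where "open U" "negligible (- U)" "\<forall>x\<in>U. P x" "open V" "negligible (- V)" "\<forall>x\<in>V. Q x"
    using assms unfolding generically_def by blast
  then show ?thesis
    unfolding generically_def by (intro exI[of _ "U \<inter> V"]) auto
qed

lemma generically_True: "generically (\<lambda>_. True)"
  unfolding generically_def by (intro exI[of _ UNIV]) auto

lemma generically_ball:
  assumes "finite I" "\<And>i. i \<in> I \<Longrightarrow> generically (P i)"
  shows "generically (\<lambda>x. \<forall>i\<in>I. P i x)"
  using assms by (induction I rule: finite_induct) (auto intro: generically_True generically_conj)

lemma generically_row_indep:
  fixes f :: "'a::euclidean_space \<Rightarrow> 't \<Rightarrow> 'k \<Rightarrow> real"
  assumes "finite T" "\<And>t k. t \<in> T \<Longrightarrow> k \<in> J \<Longrightarrow> real_polynomial_function (\<lambda>x. f x t k)"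
    "row_indep T J (f x0)"
  shows "generically (\<lambda>x. row_indep T J (f x))"
proof -
  obtain g where g: "real_polynomial_function g" "g x0 \<noteq> 0" "\<forall>x. g x \<noteq> 0 \<longrightarrow> row_indep T J (f x)"
    using polynomial_generic_row_indep[OF assms] by blast
  have "open (- {x. g x = 0})" "negligible (- (- {x. g x = 0}))"
    using negligible_zeros_real_polynomial_function[OF g(1,2)] by (auto simp: open_Compl)
  then show ?thesis
    unfolding generically_def using g(3) by blast
qed

section \<open>Tie matrices and generic flags\<close>

lemma bij_betw_idx: "bij_betw (idx :: nat \<Rightarrow> 'n::finite) {..<CARD('n)} UNIV"
proof -
  have "\<exists>f. bij_betw f {..<CARD('n)} (UNIV :: 'n set)"
    by (intro finite_same_card_bij) auto
  then show ?thesis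
    unfolding idx_def by (rule someI_ex)
qed

lemma idx_eq_iff:
  assumes "i < CARD('n)" "j < CARD('n)"
  shows "(idx i :: 'n::finite) = idx j \<longleftrightarrow> i = j"
  using bij_betw_idx[where 'n='n] assms by (auto simp: bij_betw_def inj_on_def)

lemma exists_matrix_with_rows:
  fixes y :: "nat \<Rightarrow> real^'n"
  obtains M :: "real^'n^'n" where "\<And>j. j < CARD('n) \<Longrightarrow> M $ idx j = y j"
proof
  define M :: "real^'n^'n" where "M = (\<chi> l. y (inv_into {..<CARD('n)} idx l))"
  show "M $ idx j = y j" if "j < CARD('n)" for j
    using that bij_betw_idx[where 'n='n]
    by (simp add: M_def bij_betw_def inv_into_f_f)
qed

text \<open>A tie datum \<open>T\<close> is a set of pairs \<open>(i, a)\<close> with \<open>a \<in> A i\<close>. Its tie matrix has one row for each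
  pair: the columns \<open>Inl i\<close> hold the unit vector \<open>e_i\<close>, the columns \<open>Inr j\<close> the values of given
  functionals. A column relation \<open>w\<close> thus says that the functional \<open>\<Sum>j. w (Inr j) h j\<close> takes the
  value \<open>- w (Inl i)\<close> at every point of colour \<open>i\<close>; no base point has to be chosen.\<close>

definition tie :: "(nat \<Rightarrow> nat \<times> 'a \<Rightarrow> real) \<Rightarrow> nat \<times> 'a \<Rightarrow> nat + nat \<Rightarrow> real" where
  "tie h t k = (case k of Inl i \<Rightarrow> of_bool (fst t = i) | Inr j \<Rightarrow> h j t)"

abbreviation tie_cols :: "nat \<Rightarrow> nat \<Rightarrow> (nat + nat) set" where
  "tie_cols s d \<equiv> {..<s} <+> {..<d}"

lemma tie_simps [simp]: "tie h t (Inl i) = of_bool (fst t = i)" "tie h t (Inr j) = h j t"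
  by (auto simp: tie_def)

lemma card_tie_cols: "card (tie_cols s d) = s + d"
  by (simp add: card_Plus)

lemma sum_tie_cols:
  assumes "fst t < s"
  shows "(\<Sum>k\<in>tie_cols s d. w k * tie h t k) = w (Inl (fst t)) + (\<Sum>j<d. w (Inr j) * h j t)"
proof -
  have "(\<Sum>i<s. w (Inl i) * of_bool (fst t = i)) = (\<Sum>i<s. if fst t = i then w (Inl i) else 0)"
    by (intro sum.cong) auto
  then show ?thesis
    using assms by (simp add: sum.Plus)
qed

text \<open>For pairs with first components below \<open>s\<close> this is linear independence of
  the vectors (e_i, a), the Cayley embedding of the point sets.\<close>

definition aff_indep :: "nat \<Rightarrow> (nat \<times> 'a::real_vector) set \<Rightarrow> bool" where
  "aff_indep s T \<longleftrightarrow> (\<forall>c. (\<forall>i<s. (\<Sum>t\<in>T. c t * of_bool (fst t = i)) = 0) \<longrightarrow>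
     (\<Sum>t\<in>T. c t *\<^sub>R snd t) = 0 \<longrightarrow> (\<forall>t\<in>T. c t = 0))"

lemma aff_indepD:
  assumes "aff_indep s T" "\<And>i. i < s \<Longrightarrow> (\<Sum>t\<in>T. c t * of_bool (fst t = i)) = 0"
    "(\<Sum>t\<in>T. c t *\<^sub>R snd t) = 0" "t \<in> T"
  shows "c t = 0"
  using assms unfolding aff_indep_def by blast

text \<open>With the coordinate functionals as columns this is a row-independent tie matrix, and it
  has \<open>s + CARD('n)\<close> columns.\<close>

lemma aff_indep_card_le:
  fixes T :: "(nat \<times> (real^'n)) set"
  assumes "finite T" "aff_indep s T"
  shows "card T \<le> s + CARD('n)"
proof -
  let ?h = "\<lambda>j t. snd t $ (idx j :: 'n)"
  have "row_indep T (tie_cols s CARD('n)) (tie ?h)"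
    unfolding row_indep_def
  proof (intro allI impI)
    fix c
    assume c: "\<forall>k\<in>tie_cols s CARD('n). (\<Sum>t\<in>T. c t * tie ?h t k) = 0"
    have "(\<Sum>t\<in>T. c t *\<^sub>R snd t) $ l = 0" for l
    proof -
      obtain j where j: "j < CARD('n)" "l = idx j"
        using bij_betw_idx[where 'n='n] unfolding bij_betw_def by blast
      then show ?thesis
        using c[rule_format, OF InrI, of j] by simp
    qed
    then have "(\<Sum>t\<in>T. c t *\<^sub>R snd t) = 0"
      by (simp add: vec_eq_iff)
    moreover have "(\<Sum>t\<in>T. c t * of_bool (fst t = i)) = 0" if "i < s" for i
      using c[rule_format, OF InlI, of i] that by simp
    ultimately show "\<forall>t\<in>T. c t = 0"
      using assms(2) unfolding aff_indep_def by blast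
  qed
  then show ?thesis
    using row_indep_card_le[OF assms(1)] by (metis card_tie_cols finite_Plus finite_lessThan)
qed

text \<open>More rows than columns leave a row relation \<open>c\<close> that annihilates all old
  columns. By affine independence it does not annihilate the points themselves, so \<open>y\<close>
  can be chosen such that \<open>c\<close> pairs to 1 with the new column. Pairing a column relation
  with \<open>c\<close> then shows that the new column has coefficient 0. The offset
  \<open>\<beta>\<close> is 0 when a row of the flag is chosen and the lifting when the base point
  is chosen.\<close>

lemma extend_tie_col_indep:
  fixes T :: "(nat \<times> 'a::real_inner) set"
  assumes T: "finite T" "fst ` T \<subseteq> {..<s}" and aff: "aff_indep s T" and less: "s + d < card T"
    and ind: "row_indep (tie_cols s d) T (\<lambda>k t. tie h t k)"
  obtains y where "row_indep (tie_cols s (Suc d)) T (\<lambda>k t. tie (h(d := \<lambda>t. \<beta> t - y \<bullet> snd t)) t k)"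
proof -
  obtain c t0 where t0: "t0 \<in> T" "c t0 \<noteq> 0"
    and c: "\<And>k. k \<in> tie_cols s d \<Longrightarrow> (\<Sum>t\<in>T. c t * tie h t k) = 0"
    using homogeneous_nontrivial_solution[of "tie_cols s d" T "\<lambda>k t. tie h t k"] less T
    by (metis card_tie_cols finite_Plus finite_lessThan)
  define z where "z = (\<Sum>t\<in>T. c t *\<^sub>R snd t)"
  have "z \<noteq> 0"
  proof
    assume "z = 0"
    moreover have "(\<Sum>t\<in>T. c t * of_bool (fst t = i)) = 0" if "i < s" for i
      using c[OF InlI, of i] that by simp
    ultimately have "c t0 = 0"
      using aff_indepD[OF aff] t0 unfolding z_def by blast
    then show False
      using t0 by simp
  qed
  \<comment> \<open>On the line through \<open>z\<close> the value of \<open>y \<bullet> z\<close>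
    can be prescribed; it is the pairing of \<open>c\<close> with \<open>\<beta>\<close>, less
    1.\<close>
  define y where "y = (((\<Sum>t\<in>T. c t * \<beta> t) - 1) / (z \<bullet> z)) *\<^sub>R z"
  let ?h = "h(d := \<lambda>t. \<beta> t - y \<bullet> snd t)"
  have "y \<bullet> z = (\<Sum>t\<in>T. c t * (y \<bullet> snd t))"
    by (simp add: z_def inner_sum_right)
  then have new: "(\<Sum>t\<in>T. c t * ?h d t) = 1"
    using \<open>z \<noteq> 0\<close> by (simp add: right_diff_distrib sum_subtractf) (simp add: y_def)
  have "row_indep (tie_cols s (Suc d)) T (\<lambda>k t. tie ?h t k)"
    unfolding row_indep_def
  proof (intro allI impI)
    fix w
    assume w: "\<forall>t\<in>T. (\<Sum>k\<in>tie_cols s (Suc d). w k * tie ?h t k) = 0"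
    have split: "(\<Sum>k\<in>tie_cols s (Suc d). g k) = (\<Sum>k\<in>tie_cols s d. g k) + g (Inr d)"
      for g :: "nat + nat \<Rightarrow> real"
      by (simp add: sum.Plus)
    have old: "(\<Sum>k\<in>tie_cols s d. w k * tie ?h t k) = (\<Sum>k\<in>tie_cols s d. w k * tie h t k)" for t
      by (simp add: sum.Plus)
    have "0 = (\<Sum>t\<in>T. c t * (\<Sum>k\<in>tie_cols s (Suc d). w k * tie ?h t k))"
      using w by simp
    also have "\<dots> = (\<Sum>t\<in>T. c t * (\<Sum>k\<in>tie_cols s d. w k * tie h t k)) + (\<Sum>t\<in>T. c t * (w (Inr d) * ?h d t))"
      unfolding split old by (simp only: tie_simps distrib_left sum.distrib)
    also have "(\<Sum>t\<in>T. c t * (\<Sum>k\<in>tie_cols s d. w k * tie h t k))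
        = (\<Sum>k\<in>tie_cols s d. w k * (\<Sum>t\<in>T. c t * tie h t k))"
      unfolding sum_distrib_left by (subst sum.swap) (simp add: mult_ac)
    also have "\<dots> = 0"
      using c by simp
    also have "(\<Sum>t\<in>T. c t * (w (Inr d) * ?h d t)) = w (Inr d) * (\<Sum>t\<in>T. c t * ?h d t)"
      unfolding sum_distrib_left by (simp only: mult_ac)
    also have "\<dots> = w (Inr d)"
      unfolding new by simp
    finally have d0: "w (Inr d) = 0"
      by simp
    then have "(\<Sum>k\<in>tie_cols s d. w k * tie h t k) = 0" if "t \<in> T" for t
      using w that unfolding split old by auto
    then have "w k = 0" if "k \<in> tie_cols s d" for k
      using row_indepD[OF ind] that by blast
    then show "\<forall>k\<in>tie_cols s (Suc d). w k = 0"
      using d0 by (auto simp: Plus_def less_Suc_eq)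
  qed
  then show thesis by (rule that)
qed

lemma exists_tie_col_indep:
  fixes T :: "(nat \<times> 'a::real_inner) set"
  assumes T: "finite T" "fst ` T = {..<s}" and aff: "aff_indep s T" and le: "s + d \<le> card T"
  obtains y where "row_indep (tie_cols s d) T (\<lambda>k t. tie (\<lambda>j t. y j \<bullet> snd t) t k)"
  using le
proof (induction d arbitrary: thesis)
  case 0
  \<comment> \<open>Without functionals only the colour columns remain; they are independent because
    every colour occurs in \<open>T\<close>.\<close>
  have "row_indep (tie_cols s 0) T (\<lambda>k t. tie (\<lambda>j t. 0 \<bullet> snd t) t k)"
    unfolding row_indep_def
  proof (intro allI impI ballI)
    fix w k
    assume w: "\<forall>t\<in>T. (\<Sum>k\<in>tie_cols s 0. w k * tie (\<lambda>j t. 0 \<bullet> snd t) t k) = 0"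
      and k: "k \<in> tie_cols s 0"
    then obtain i where i: "k = Inl i" "i < s"
      by auto
    then obtain t where t: "t \<in> T" "fst t = i"
      using T(2) by (metis image_iff lessThan_iff)
    have "(\<Sum>k\<in>tie_cols s 0. w k * tie (\<lambda>j t. 0 \<bullet> snd t) t k) = w (Inl (fst t)) + 0"
      using sum_tie_cols[where t=t and s=s and w=w and d=0] t i by simp
    then show "w k = 0"
      using w t i by simp
  qed
  then show ?case
    by (rule 0)
next
  case (Suc d)
  obtain y where y: "row_indep (tie_cols s d) T (\<lambda>k t. tie (\<lambda>j t. y j \<bullet> snd t) t k)"
    using Suc.IH Suc.prems(2) by auto
  obtain z where z: "row_indep (tie_cols s (Suc d)) T
      (\<lambda>k t. tie ((\<lambda>j t. y j \<bullet> snd t)(d := \<lambda>t. 0 - z \<bullet> snd t)) t k)"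
    using extend_tie_col_indep[where \<beta>="\<lambda>_. 0", OF T(1) _ aff _ y] T(2) Suc.prems(2) by auto
  have "(\<lambda>j t :: nat \<times> 'a. y j \<bullet> snd t)(d := \<lambda>t. 0 - z \<bullet> snd t) = (\<lambda>j t. (y(d := - z)) j \<bullet> snd t)"
    by auto
  then show ?case
    using Suc.prems(1)[of "y(d := - z)"] z by (simp only:)
qed

definition row_form :: "real^'n^'n \<Rightarrow> nat \<Rightarrow> nat \<times> (real^'n) \<Rightarrow> real" where
  "row_form M j t = M $ idx j \<bullet> snd t"

text \<open>The first kind of square tie matrix decides whether the ties in \<open>T\<close> are independent on the
  direction space of \<open>F e\<close>, the second kind whether the ties can hold at a point of \<open>F e\<close>.\<close>

definition generic_flag ::
    "(nat \<Rightarrow> (real^'n) set) \<Rightarrow> (nat \<Rightarrow> real^'n \<Rightarrow> real) \<Rightarrow> nat \<Rightarrow> real^'n \<Rightarrow> real^'n^'n \<Rightarrow> bool" where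
  "generic_flag A b s p M \<longleftrightarrow>
     row_indep {..<CARD('n)} UNIV (\<lambda>j l. M $ idx j $ l) \<and>
     (\<forall>T \<in> {T. T \<subseteq> Sigma {..<s} A \<and> fst ` T = {..<s} \<and> aff_indep s T}. \<forall>e \<in> {..CARD('n)}.
       (card T = s + e \<longrightarrow> row_indep T (tie_cols s e) (tie (row_form M))) \<and>
       (card T = Suc (s + e) \<longrightarrow> row_indep T (tie_cols s (Suc e))
          (tie ((row_form M)(e := \<lambda>t. b (fst t) (snd t) - p \<bullet> snd t)))))"

lemma real_polynomial_function_row_form:
  "real_polynomial_function (\<lambda>x :: 'a::real_normed_vector \<times> (real^'n^'n). row_form (snd x) j t)"
proof (rule real_polynomial_function.intros(1))
  have "bounded_linear (\<lambda>x :: 'a \<times> (real^'n^'n). snd x $ idx j)"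
    by (rule bounded_linear_compose[OF bounded_linear_vec_nth bounded_linear_snd])
  then show "bounded_linear (\<lambda>x :: 'a \<times> (real^'n^'n). row_form (snd x) j t)"
    unfolding row_form_def by (rule bounded_linear_inner_left_comp)
qed

text \<open>It is enough to find a witness for each condition separately, since finitely many
  generic conditions can be met together; the witnesses need not agree.\<close>

lemma generically_generic_flag:
  fixes A :: "nat \<Rightarrow> (real^'n) set"
  assumes A: "\<forall>i<s. finite (A i)"
  shows "generically (\<lambda>(p, M). generic_flag A b s p M)"
proof -
  let ?\<T> = "{T. T \<subseteq> Sigma {..<s} A \<and> fst ` T = {..<s} \<and> aff_indep s T}"
  have fin: "finite (Sigma {..<s} A)"
    using A by auto
  then have fin\<T>: "finite ?\<T>"
    by (rule finite_subset[rotated, OF finite_Collect_subsets]) auto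
  obtain M :: "real^'n^'n" where M: "\<And>j. j < CARD('n) \<Longrightarrow> M $ idx j = axis (idx j) 1"
    using exists_matrix_with_rows[of "\<lambda>j. axis (idx j :: 'n) 1"] by blast
  have rows: "generically (\<lambda>x :: (real^'n) \<times> (real^'n^'n). row_indep {..<CARD('n)} UNIV (\<lambda>j l. snd x $ idx j $ l))"
  proof (rule generically_row_indep[where ?x0.0="(0, M)"])
    fix j :: nat and l :: 'n
    show "real_polynomial_function (\<lambda>x :: (real^'n) \<times> (real^'n^'n). snd x $ idx j $ l)"
      by (intro real_polynomial_function.intros(1) bounded_linear_vec_nth[THEN bounded_linear_compose] bounded_linear_snd)
  next
    show "row_indep {..<CARD('n)} UNIV (\<lambda>j l. snd (0::real^'n, M) $ idx j $ l)"
      unfolding row_indep_def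
    proof (intro allI impI ballI)
      fix c j
      assume c: "\<forall>k\<in>UNIV. (\<Sum>t<CARD('n). c t * snd (0::real^'n, M) $ idx t $ k) = 0"
        and j: "j \<in> {..<CARD('n)}"
      have "(\<Sum>t<CARD('n). c t * snd (0::real^'n, M) $ idx t $ idx j)
          = (\<Sum>t<CARD('n). if t = j then c t else 0)"
        using j by (intro sum.cong) (auto simp: M axis_def idx_eq_iff)
      then show "c j = 0"
        using c j by simp
    qed
  qed simp
  have ties: "generically (\<lambda>x :: (real^'n) \<times> (real^'n^'n). card T = s + e \<longrightarrow>
      row_indep T (tie_cols s e) (tie (row_form (snd x))))"
    if T: "T \<in> ?\<T>" for T e
  proof (cases "card T = s + e")
    case False
    then show ?thesis by (simp add: generically_True)
  next
    case True
    have finT: "finite T"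
      using T fin finite_subset by blast
    \<comment> \<open>Affine independence bounds the size of \<open>T\<close>, so the matrix has all
      the rows that are to be prescribed.\<close>
    have e: "e \<le> CARD('n)"
      using aff_indep_card_le[OF finT, of s] T True by auto
    obtain y where y: "row_indep (tie_cols s e) T (\<lambda>k t. tie (\<lambda>j t. y j \<bullet> snd t) t k)"
      using exists_tie_col_indep[OF finT, of s e] T True by auto
    obtain M :: "real^'n^'n" where M: "\<And>j. j < CARD('n) \<Longrightarrow> M $ idx j = y j"
      using exists_matrix_with_rows[of y] by blast
    have "row_indep T (tie_cols s e) (tie (\<lambda>j t. y j \<bullet> snd t))"
      using row_indep_square_transpose[OF _ finT _ y] True by (simp add: card_tie_cols)
    then have "row_indep T (tie_cols s e) (tie (row_form (snd (0::real^'n, M))))"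
      using M e by (subst row_indep_cong[where g="tie (\<lambda>j t. y j \<bullet> snd t)"]) (auto simp: row_form_def)
    then have "generically (\<lambda>x :: (real^'n) \<times> (real^'n^'n). row_indep T (tie_cols s e) (tie (row_form (snd x))))"
      by (rule generically_row_indep[OF finT, rotated])
        (auto intro: real_polynomial_function_row_form real_polynomial_function.intros(2))
    then show ?thesis
      by (rule generically_mono) simp
  qed
  have miss: "generically (\<lambda>x :: (real^'n) \<times> (real^'n^'n). card T = Suc (s + e) \<longrightarrow>
      row_indep T (tie_cols s (Suc e))
        (tie ((row_form (snd x))(e := \<lambda>t. b (fst t) (snd t) - fst x \<bullet> snd t))))"
    if T: "T \<in> ?\<T>" for T e
  proof (cases "card T = Suc (s + e)")
    case False
    then show ?thesis by (simp add: generically_True)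
  next
    case True
    let ?\<beta> = "\<lambda>t. b (fst t) (snd t)"
    have finT: "finite T"
      using T fin finite_subset by blast
    have e: "e < CARD('n)"
      using aff_indep_card_le[OF finT, of s] T True by auto
    obtain y where y: "row_indep (tie_cols s e) T (\<lambda>k t. tie (\<lambda>j t. y j \<bullet> snd t) t k)"
      using exists_tie_col_indep[OF finT, of s e] T True by auto
    \<comment> \<open>The base point is chosen after the rows: it enters only column
      \<open>e\<close>, and a suitable choice makes this column independent of the others.\<close>
    obtain p where p: "row_indep (tie_cols s (Suc e)) T
        (\<lambda>k t. tie ((\<lambda>j t. y j \<bullet> snd t)(e := \<lambda>t. ?\<beta> t - p \<bullet> snd t)) t k)"
      using extend_tie_col_indep[where \<beta>="?\<beta>", OF finT _ _ _ y] T True by auto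
    obtain M :: "real^'n^'n" where M: "\<And>j. j < CARD('n) \<Longrightarrow> M $ idx j = y j"
      using exists_matrix_with_rows[of y] by blast
    have "row_indep T (tie_cols s (Suc e)) (tie ((\<lambda>j t. y j \<bullet> snd t)(e := \<lambda>t. ?\<beta> t - p \<bullet> snd t)))"
      using row_indep_square_transpose[OF _ finT _ p] True by (simp add: card_tie_cols)
    then have "row_indep T (tie_cols s (Suc e))
        (tie ((row_form (snd (p, M)))(e := \<lambda>t. ?\<beta> t - fst (p, M) \<bullet> snd t)))"
      using M e
      by (subst row_indep_cong[where g="tie ((\<lambda>j t. y j \<bullet> snd t)(e := \<lambda>t. ?\<beta> t - p \<bullet> snd t))"])
        (auto simp: row_form_def)
    then have "generically (\<lambda>x :: (real^'n) \<times> (real^'n^'n). row_indep T (tie_cols s (Suc e))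
        (tie ((row_form (snd x))(e := \<lambda>t. ?\<beta> t - fst x \<bullet> snd t))))"
    proof (rule generically_row_indep[OF finT, rotated])
      have "real_polynomial_function (\<lambda>x :: (real^'n) \<times> (real^'n^'n). ?\<beta> t - fst x \<bullet> snd t)" for t
        by (intro real_polynomial_function_diff real_polynomial_function.intros(2)
            real_polynomial_function.intros(1) bounded_linear_inner_left_comp bounded_linear_fst)
      then show "real_polynomial_function (\<lambda>x :: (real^'n) \<times> (real^'n^'n).
          tie ((row_form (snd x))(e := \<lambda>t. ?\<beta> t - fst x \<bullet> snd t)) t k)"
        if "k \<in> tie_cols s (Suc e)" for t k
      proof (cases k)
        case (Inl i)
        then show ?thesis
          by (simp add: real_polynomial_function.intros(2))
      next
        case (Inr j)
        then show ?thesis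
          using \<open>\<And>t. real_polynomial_function (\<lambda>x. ?\<beta> t - fst x \<bullet> snd t)\<close>
            real_polynomial_function_row_form[of j t]
          by (cases "j = e") simp_all
      qed
    qed
    then show ?thesis
      by (rule generically_mono) simp
  qed
  have "generically (\<lambda>x. row_indep {..<CARD('n)} UNIV (\<lambda>j l. snd x $ idx j $ l) \<and>
     (\<forall>T \<in> ?\<T>. \<forall>e \<in> {..CARD('n)}.
       (card T = s + e \<longrightarrow> row_indep T (tie_cols s e) (tie (row_form (snd x)))) \<and>
       (card T = Suc (s + e) \<longrightarrow> row_indep T (tie_cols s (Suc e))
          (tie ((row_form (snd x))(e := \<lambda>t. b (fst t) (snd t) - fst x \<bullet> snd t))))))"
    by (intro generically_conj rows generically_ball fin\<T> finite_atMost ties miss)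
  then show ?thesis
    by (rule generically_mono) (auto simp: generic_flag_def)
qed

section \<open>Segments and half-lines\<close>

lemma seg_or_halfline_connected:
  fixes L :: "'a::real_normed_vector set"
  assumes "seg_or_halfline L"
  shows "connected L"
proof -
  have "halfline x v = (\<lambda>t. x + t *\<^sub>R v) ` {0..}" for x v :: 'a
    by (auto simp: halfline_def)
  moreover have "connected ((\<lambda>t. x + t *\<^sub>R v) ` {0..})" for x v :: 'a
    by (intro connected_continuous_image continuous_intros convex_connected) auto
  ultimately show ?thesis
    using assms unfolding seg_or_halfline_def by auto
qed

lemma seg_or_halfline_inner_attains_min:
  fixes L :: "'a::real_inner set"
  assumes L: "seg_or_halfline L" and bd: "\<And>x. x \<in> L \<Longrightarrow> c \<le> u \<bullet> x"
  obtains x where "x \<in> L" "\<And>y. y \<in> L \<Longrightarrow> u \<bullet> x \<le> u \<bullet> y"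
proof -
  from L consider x y where "L = closed_segment x y" | x v where "L = halfline x v"
    unfolding seg_or_halfline_def by blast
  then show thesis
  proof cases
    case 1
    have "\<exists>z\<in>L. \<forall>y\<in>L. u \<bullet> z \<le> u \<bullet> y"
      unfolding 1 by (intro continuous_attains_inf continuous_intros) auto
    then show ?thesis using that by blast
  next
    case 2
    have "0 \<le> u \<bullet> v"
    proof (rule ccontr)
      assume neg: "\<not> 0 \<le> u \<bullet> v"
      \<comment> \<open>Far enough along the half-line for the functional to drop below
        \<open>c\<close>.\<close>
      define t where "t = (\<bar>c - u \<bullet> x\<bar> + 1) / - (u \<bullet> v)"
      have "0 \<le> t"
        unfolding t_def by (rule divide_nonneg_pos) (use neg in auto)
      then have "c \<le> u \<bullet> (x + t *\<^sub>R v)"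
        using bd[of "x + t *\<^sub>R v"] 2 by (auto simp: halfline_def)
      moreover have "t * (u \<bullet> v) = - (\<bar>c - u \<bullet> x\<bar> + 1)"
        using neg by (simp add: t_def)
      ultimately show False
        by (simp add: inner_add_right)
    qed
    then have "u \<bullet> x \<le> u \<bullet> y" if "y \<in> L" for y
      using that 2 by (auto simp: halfline_def inner_add_right)
    moreover have "x \<in> L"
      unfolding 2 halfline_def by (auto intro: exI[of _ 0])
    ultimately show ?thesis using that by blast
  qed
qed

text \<open>The parameters \<open>t\<close> form a closed, downward closed subset of the nonnegative
  reals: either an interval from 0 to its supremum or everything. The point at
  \<open>\<epsilon>\<close> rules out the degenerate interval.\<close>

lemma closed_convex_ray_seg_or_halfline:
  fixes P :: "'a::real_normed_vector set"
  assumes P: "closed P" "convex P" and x: "x \<in> P" and w: "w \<noteq> 0" and \<epsilon>: "0 < \<epsilon>" "x + \<epsilon> *\<^sub>R w \<in> P"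
  shows "seg_or_halfline {y \<in> P. \<exists>t\<ge>0. y = x + t *\<^sub>R w}"
proof -
  define S where "S = {t. 0 \<le> t \<and> x + t *\<^sub>R w \<in> P}"
  have eq: "{y \<in> P. \<exists>t\<ge>0. y = x + t *\<^sub>R w} = (\<lambda>t. x + t *\<^sub>R w) ` S"
    by (auto simp: S_def)
  have S0: "0 \<in> S" and S\<epsilon>: "\<epsilon> \<in> S"
    using x \<epsilon> by (auto simp: S_def)
  have down: "t \<in> S" if "t' \<in> S" "0 \<le> t" "t \<le> t'" for t t'
  proof (cases "t' = 0")
    case False
    have "(1 - t / t') *\<^sub>R x + (t / t') *\<^sub>R (x + t' *\<^sub>R w) \<in> P"
      using that False P(2) x by (intro convexD_alt) (auto simp: S_def)
    moreover have "(1 - t / t') *\<^sub>R x + (t / t') *\<^sub>R (x + t' *\<^sub>R w) = x + t *\<^sub>R w"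
      using False by (simp add: algebra_simps)
    ultimately show ?thesis
      using that by (simp add: S_def)
  qed (use that in auto)
  show ?thesis
  proof (cases "bdd_above S")
    case True
    have "closed S"
    proof -
      have "closed ({0..} \<inter> (\<lambda>t. x + t *\<^sub>R w) -` P)"
        by (intro closed_Int closed_vimage P continuous_intros closed_atLeast)
      moreover have "S = {0..} \<inter> (\<lambda>t. x + t *\<^sub>R w) -` P"
        by (auto simp: S_def)
      ultimately show ?thesis by simp
    qed
    then have SupS: "Sup S \<in> S"
      using closed_contains_Sup[of S] S0 True by blast
    have le: "t \<le> Sup S" if "t \<in> S" for t
      using that True by (rule cSup_upper)
    have pos: "0 < Sup S"
      using le[OF S\<epsilon>] \<epsilon> by simp
    have "S = {0..Sup S}"
    proof
      show "S \<subseteq> {0..Sup S}"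
        using le by (auto simp: S_def)
      show "{0..Sup S} \<subseteq> S"
        using down[OF SupS] by auto
    qed
    then have "(\<lambda>t. x + t *\<^sub>R w) ` S = (\<lambda>t. x + t *\<^sub>R w) ` closed_segment 0 (Sup S)"
      using pos by (simp add: closed_segment_eq_real_ivl)
    also have "\<dots> = closed_segment x (x + Sup S *\<^sub>R w)"
    proof -
      have "(\<lambda>t. x + t *\<^sub>R w) ` closed_segment 0 (Sup S) = (+) x ` ((\<lambda>t. t *\<^sub>R w) ` closed_segment 0 (Sup S))"
        by (simp add: image_image)
      also have "(\<lambda>t. t *\<^sub>R w) ` closed_segment 0 (Sup S) = closed_segment (0 *\<^sub>R w) (Sup S *\<^sub>R w)"
        by (rule closed_segment_linear_image[symmetric]) (simp add: linear_scaleR_left)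
      finally show ?thesis
        using closed_segment_translation[of x 0 "Sup S *\<^sub>R w"] by simp
    qed
    finally show ?thesis
      unfolding eq seg_or_halfline_def using pos w by (intro disjI1 exI[of _ x] exI[of _ "x + Sup S *\<^sub>R w"]) auto
  next
    case False
    have "t \<in> S" if t: "0 \<le> t" for t
    proof -
      obtain t' where "t' \<in> S" "t < t'"
        using False by (meson bdd_aboveI not_le)
      then show ?thesis
        using down t by auto
    qed
    then have "S = {0..}"
      by (auto simp: S_def)
    then have "(\<lambda>t. x + t *\<^sub>R w) ` S = halfline x w"
      by (auto simp: halfline_def)
    then show ?thesis
      unfolding eq seg_or_halfline_def using w by blast
  qed
qed

text \<open>\<open>P\<close> may be a whole line, which is neither a segment nor a half-line;
  cutting at \<open>x\<close> yields two rays, and the opposite one is dropped if it is just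
  \<open>x\<close>.\<close>

lemma closed_convex_in_line_is_union:
  fixes P :: "'a::real_normed_vector set"
  assumes P: "closed P" "convex P" and x: "x \<in> P" and w: "w \<noteq> 0" and \<epsilon>: "0 < \<epsilon>" "x + \<epsilon> *\<^sub>R w \<in> P"
    and line: "\<And>y. y \<in> P \<Longrightarrow> \<exists>t. y = x + t *\<^sub>R w"
  shows "\<exists>\<L>. finite \<L> \<and> (\<forall>L\<in>\<L>. seg_or_halfline L) \<and> P = \<Union>\<L>"
proof -
  define L1 where "L1 = {y \<in> P. \<exists>t\<ge>0. y = x + t *\<^sub>R w}"
  define L2 where "L2 = {y \<in> P. \<exists>t\<ge>0. y = x + t *\<^sub>R (- w)}"
  have L1: "seg_or_halfline L1"
    unfolding L1_def by (rule closed_convex_ray_seg_or_halfline[OF P x w \<epsilon>])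
  have x1: "x \<in> L1"
    using x by (auto simp: L1_def intro: exI[of _ 0])
  have "y \<in> L1 \<union> L2" if y: "y \<in> P" for y
  proof -
    obtain t where t: "y = x + t *\<^sub>R w"
      using line[OF y] by blast
    show ?thesis
    proof (cases "0 \<le> t")
      case True
      then show ?thesis using y t by (auto simp: L1_def)
    next
      case False
      then have "y = x + (- t) *\<^sub>R (- w)" "0 \<le> - t"
        using t by auto
      then show ?thesis using y unfolding L2_def by blast
    qed
  qed
  then have P_eq: "P = L1 \<union> L2"
    by (auto simp: L1_def L2_def)
  show ?thesis
  proof (cases "L2 \<subseteq> {x}")
    case True
    then have "P = \<Union>{L1}"
      using P_eq x1 by auto
    then show ?thesis
      using L1 by (intro exI[of _ "{L1}"]) auto
  next
    case False
    then obtain y t where y: "y \<in> P" "0 \<le> t" "y = x + t *\<^sub>R (- w)" "y \<noteq> x"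
      unfolding L2_def by blast
    then have "0 < t"
      by (cases "t = 0") auto
    then have "seg_or_halfline L2"
      unfolding L2_def using y w by (intro closed_convex_ray_seg_or_halfline[OF P x, of _ t]) auto
    then show ?thesis
      using L1 P_eq by (intro exI[of _ "{L1, L2}"]) auto
  qed
qed

section \<open>Maximal points\<close>

text \<open>A point of space may belong to several \<open>A i\<close>, so maximal points are tagged
  with their colour.\<close>

definition top_set :: "(nat \<Rightarrow> (real^'n) set) \<Rightarrow> (nat \<Rightarrow> real^'n \<Rightarrow> real) \<Rightarrow> nat \<Rightarrow> real^'n \<Rightarrow> (nat \<times> (real^'n)) set" where
  "top_set A b s \<xi> = Sigma {..<s} (\<lambda>i. top_pts A b i \<xi>)"

definition top_val :: "(nat \<Rightarrow> (real^'n) set) \<Rightarrow> (nat \<Rightarrow> real^'n \<Rightarrow> real) \<Rightarrow> real^'n \<Rightarrow> nat \<Rightarrow> real" where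
  "top_val A b \<xi> i = Max ((\<lambda>a. \<xi> \<bullet> a - b i a) ` A i)"

lemma top_set_iff: "t \<in> top_set A b s \<xi> \<longleftrightarrow> fst t < s \<and> snd t \<in> top_pts A b (fst t) \<xi>"
  by (cases t) (auto simp: top_set_def)

lemma top_set_subset: "top_set A b s \<xi> \<subseteq> Sigma {..<s} A"
  by (auto simp: top_set_def top_pts_def)

lemma top_val_eq:
  assumes "finite (A i)" "a \<in> top_pts A b i \<xi>"
  shows "\<xi> \<bullet> a - b i a = top_val A b \<xi> i"
  unfolding top_val_def using assms by (intro Max_eqI[symmetric]) (auto simp: top_pts_def)

text \<open>General position speaks only of boundedly many vectors. Small subsets are treated
  directly, and they yield a bound on all maximal pairs that makes every \<open>T\<close>
  small.\<close>

lemma lifting_general_position_top_aff_indep: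
  fixes A :: "nat \<Rightarrow> (real^'n) set"
  assumes gp: "lifting_general_position A b s" and s: "s \<le> CARD('n)" and A: "\<forall>i<s. finite (A i)"
    and T: "T \<subseteq> top_set A b s \<xi>"
  shows "aff_indep s T"
proof -
  define lift :: "nat \<times> (real^'n) \<Rightarrow> (real^'n) \<times> (real^'n) \<times> real"
    where "lift = (\<lambda>t. (- axis (idx (fst t)) 1, snd t, b (fst t) (snd t)))"
  define z :: "(real^'n) \<times> (real^'n) \<times> real"
    where "z = ((\<Sum>i<s. top_val A b \<xi> i *\<^sub>R axis (idx i) 1), \<xi>, - 1)"
  have fin: "finite (top_set A b s \<xi>)"
    using A by (intro finite_subset[OF top_set_subset]) auto
  have fst_lt: "fst t < s" if "t \<in> top_set A b s \<xi>" for t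
    using that by (simp add: top_set_iff)
  have idx_inj: "(idx i :: 'n) = idx j \<longleftrightarrow> i = j" if "i < s" "j < s" for i j
    using that s by (intro idx_eq_iff) auto
  have inj: "inj_on lift (top_set A b s \<xi>)"
    by (rule inj_onI) (auto simp: lift_def axis_eq_axis idx_inj fst_lt prod_eq_iff)
  have orth: "z \<bullet> lift t = 0" if t: "t \<in> top_set A b s \<xi>" for t
  proof -
    have "(\<Sum>i<s. top_val A b \<xi> i *\<^sub>R axis (idx i) 1) \<bullet> axis (idx (fst t) :: 'n) (1 :: real)
        = (\<Sum>i<s. if i = fst t then top_val A b \<xi> i else 0)"
      unfolding inner_sum_left
      using fst_lt[OF t] by (intro sum.cong) (auto simp: inner_axis_axis idx_inj)
    also have "\<dots> = \<xi> \<bullet> snd t - b (fst t) (snd t)"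
      using t A top_val_eq[of A "fst t" "snd t" b \<xi>] by (simp add: top_set_iff)
    finally show ?thesis
      by (simp add: z_def lift_def inner_prod_def)
  qed
  have small: "aff_indep s R" if R: "R \<subseteq> top_set A b s \<xi>" and card: "card R \<le> CARD('n) + s + 1" for R
    unfolding aff_indep_def
  proof (intro allI impI ballI)
    fix c t
    assume c1: "\<forall>i<s. (\<Sum>t\<in>R. c t * of_bool (fst t = i)) = 0" and c2: "(\<Sum>t\<in>R. c t *\<^sub>R snd t) = 0"
      and t: "t \<in> R"
    have finR: "finite R" and injR: "inj_on lift R"
      using R fin inj by (auto intro: finite_subset inj_on_subset)
    have "lift ` R \<subseteq> lift_vecs A b s"
      using R top_set_subset[of A b s \<xi>] by (fastforce simp: lift_vecs_def lift_def)
    moreover have "card (lift ` R) \<le> CARD('n) + s + 1"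
      using card injR by (simp add: card_image)
    ultimately have "independent (lift ` R) \<or> (0, 0, 1) \<in> span (lift ` R)"
      using gp unfolding lifting_general_position_def by blast
    moreover have "(0, 0, 1) \<notin> span (lift ` R)"
    proof
      assume "(0, 0, 1) \<in> span (lift ` R)"
      moreover have "span (lift ` R) \<subseteq> {v. z \<bullet> v = 0}"
        using R orth by (intro span_minimal subspace_hyperplane) auto
      ultimately have "z \<bullet> (0, 0, 1) = 0"
        by blast
      then show False
        by (simp add: z_def inner_prod_def)
    qed
    ultimately have ind: "independent (lift ` R)"
      by blast
    \<comment> \<open>A relation among colours and points lifts to a relation up to the last
      coordinate, which is this \<open>\<beta>\<close>. Pairing with \<open>z\<close>, whose last
      coordinate is -1, forces it to be 0.\<close>
    define \<beta> where "\<beta> = (\<Sum>t\<in>R. c t * b (fst t) (snd t))"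
    have c1': "(\<Sum>t\<in>R. c t *\<^sub>R axis (idx (fst t) :: 'n) (1 :: real)) = 0"
    proof -
      have "c t *\<^sub>R axis (idx (fst t) :: 'n) (1 :: real)
          = (\<Sum>i<s. (c t * of_bool (fst t = i)) *\<^sub>R axis (idx i) 1)" if "t \<in> R" for t
      proof -
        have "(\<Sum>i<s. (c t * of_bool (fst t = i)) *\<^sub>R axis (idx i :: 'n) (1 :: real))
            = (\<Sum>i<s. if i = fst t then c t *\<^sub>R axis (idx i) 1 else 0)"
          by (intro sum.cong) auto
        then show ?thesis
          using fst_lt[OF subsetD[OF R that]] by simp
      qed
      then have "(\<Sum>t\<in>R. c t *\<^sub>R axis (idx (fst t) :: 'n) (1 :: real))
          = (\<Sum>t\<in>R. \<Sum>i<s. (c t * of_bool (fst t = i)) *\<^sub>R axis (idx i) 1)"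
        by simp
      also have "\<dots> = (\<Sum>i<s. (\<Sum>t\<in>R. c t * of_bool (fst t = i)) *\<^sub>R axis (idx i) 1)"
        by (subst sum.swap) (simp add: scaleR_sum_left)
      also have "\<dots> = 0"
        using c1 by simp
      finally show ?thesis .
    qed
    have lift_sum: "(\<Sum>t\<in>R. c t *\<^sub>R lift t) = (0, 0, \<beta>)"
      using c1' c2 by (simp add: prod_eq_iff fst_sum snd_sum lift_def \<beta>_def sum_negf)
    have "z \<bullet> (\<Sum>t\<in>R. c t *\<^sub>R lift t) = 0"
      using orth[OF subsetD[OF R]] by (simp add: inner_sum_right)
    then have "\<beta> = 0"
      unfolding lift_sum by (simp add: z_def inner_prod_def)
    then have "(\<Sum>v\<in>lift ` R. c (inv_into R lift v) *\<^sub>R v) = 0"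
      using lift_sum injR by (simp add: sum.reindex inv_into_f_f zero_prod_def)
    then have "c (inv_into R lift (lift t)) = 0"
      using independentD[OF ind, of "lift ` R" "\<lambda>v. c (inv_into R lift v)"] finR t by blast
    then show "c t = 0"
      using injR t by simp
  qed
  \<comment> \<open>The size allowed in general position is one more than the bound for
    \<open>aff_indep\<close> sets, so a subset of that size would be contradictory.\<close>
  have "card (top_set A b s \<xi>) \<le> CARD('n) + s"
  proof (rule ccontr)
    assume "\<not> ?thesis"
    then obtain R where R: "R \<subseteq> top_set A b s \<xi>" "card R = CARD('n) + s + 1" "finite R"
      using obtain_subset_with_card_n[of "CARD('n) + s + 1" "top_set A b s \<xi>"] by auto
    then show False
      using aff_indep_card_le[OF R(3) small[OF R(1)]] by simp
  qed
  then have "card T \<le> CARD('n) + s + 1"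
    using card_mono[OF fin T] by simp
  then show ?thesis
    using small[OF T] by blast
qed

section \<open>Direction spaces of the flag and small moves from a point\<close>

abbreviation row_span :: "real^'n^'n \<Rightarrow> nat \<Rightarrow> (real^'n) set" where
  "row_span M d \<equiv> span {M $ idx j | j. j < d}"

lemma row_span_iff: "v \<in> row_span M d \<longleftrightarrow> (\<exists>c. v = (\<Sum>j<d. c j *\<^sub>R M $ idx j))"
proof
  assume "v \<in> span {M $ idx j | j. j < d}"
  then show "\<exists>c. v = (\<Sum>j<d. c j *\<^sub>R M $ idx j)"
  proof (induction rule: span_induct_alt)
    case base
    show ?case by (intro exI[of _ "\<lambda>_. 0"]) simp
  next
    case (step r x y)
    then obtain c j where c: "y = (\<Sum>j<d. c j *\<^sub>R M $ idx j)" and j: "x = M $ idx j" "j < d"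
      by blast
    have "(\<Sum>l<d. (if l = j then r else 0) *\<^sub>R M $ idx l) = (\<Sum>l<d. if l = j then r *\<^sub>R M $ idx l else 0)"
      by (intro sum.cong) auto
    then have "r *\<^sub>R x + y = (\<Sum>l<d. ((if l = j then r else 0) + c l) *\<^sub>R M $ idx l)"
      using c j by (simp add: scaleR_left_distrib sum.distrib)
    then show ?case by (intro exI[of _ "\<lambda>l. (if l = j then r else 0) + c l"])
  qed
next
  assume "\<exists>c. v = (\<Sum>j<d. c j *\<^sub>R M $ idx j)"
  then show "v \<in> span {M $ idx j | j. j < d}"
    by (fastforce intro: span_sum span_scale span_base)
qed

lemma flag_iff: "x \<in> flag p M d \<longleftrightarrow> (\<exists>c. x = p + (\<Sum>j<d. c j *\<^sub>R M $ idx j))"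
  by (auto simp: flag_def image_iff row_span_iff)

lemma flag_add: "x \<in> flag p M d \<Longrightarrow> v \<in> row_span M d \<Longrightarrow> x + v \<in> flag p M d"
  unfolding flag_def by (auto simp: add.assoc intro!: imageI span_add)

lemma flag_diff: "x \<in> flag p M d \<Longrightarrow> y \<in> flag p M d \<Longrightarrow> y - x \<in> row_span M d"
  unfolding flag_def by (auto intro: span_diff)

lemma flag_mono: "d \<le> e \<Longrightarrow> flag p M d \<subseteq> flag p M e"
  unfolding flag_def by (intro image_mono span_mono) auto

lemma closed_flag: "closed (flag p M d)"
  unfolding flag_def by (intro closed_translation closed_span)

lemma convex_flag: "convex (flag p M d)"
  unfolding flag_def by (intro convex_translation subspace_imp_convex subspace_span)

text \<open>For a short move along \<open>v\<close>, points strictly below the maximum stay below by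
  continuity, and among the maximal points of a colour only the slopes along \<open>v\<close>
  decide. Finiteness gives a common range.\<close>

lemma top_set_stable:
  assumes A: "\<forall>i<s. finite (A i)" and R: "R \<subseteq> top_set A b s \<xi>"
    and max: "\<And>t t'. t \<in> R \<Longrightarrow> t' \<in> top_set A b s \<xi> \<Longrightarrow> fst t' = fst t \<Longrightarrow> snd t' \<bullet> v \<le> snd t \<bullet> v"
  obtains \<epsilon> where "0 < \<epsilon>" "\<And>r. 0 \<le> r \<Longrightarrow> r \<le> \<epsilon> \<Longrightarrow> R \<subseteq> top_set A b s (\<xi> + r *\<^sub>R v)"
proof -
  have fin: "finite R"
    using A by (intro finite_subset[OF R] finite_subset[OF top_set_subset]) auto
  have "\<forall>\<^sub>F r in at_right 0. \<forall>t\<in>R. \<forall>a'\<in>A (fst t).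
      (\<xi> + r *\<^sub>R v) \<bullet> a' - b (fst t) a' \<le> (\<xi> + r *\<^sub>R v) \<bullet> snd t - b (fst t) (snd t)"
  proof (intro eventually_ball_finite fin ballI)
    fix t assume t: "t \<in> R"
    then have t': "fst t < s" "snd t \<in> top_pts A b (fst t) \<xi>"
      using R top_set_iff by blast+
    then show "finite (A (fst t))"
      using A by blast
    fix a' assume a': "a' \<in> A (fst t)"
    have le: "\<xi> \<bullet> a' - b (fst t) a' \<le> \<xi> \<bullet> snd t - b (fst t) (snd t)"
      using t' a' by (auto simp: top_pts_def)
    show "\<forall>\<^sub>F r in at_right 0. (\<xi> + r *\<^sub>R v) \<bullet> a' - b (fst t) a' \<le> (\<xi> + r *\<^sub>R v) \<bullet> snd t - b (fst t) (snd t)"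
    proof (cases "\<xi> \<bullet> a' - b (fst t) a' = \<xi> \<bullet> snd t - b (fst t) (snd t)")
      case True
      then have "(fst t, a') \<in> top_set A b s \<xi>"
        using t' a' by (auto simp: top_set_iff top_pts_def)
      then have "a' \<bullet> v \<le> snd t \<bullet> v"
        using max[OF t] by force
      then have "(\<xi> + r *\<^sub>R v) \<bullet> a' - b (fst t) a' \<le> (\<xi> + r *\<^sub>R v) \<bullet> snd t - b (fst t) (snd t)" if "0 < r" for r
      proof -
        have "r * (a' \<bullet> v) \<le> r * (snd t \<bullet> v)"
          using \<open>a' \<bullet> v \<le> snd t \<bullet> v\<close> that by simp
        then show ?thesis
          using True unfolding inner_add_left inner_scaleR_left inner_commute[of v] by linarith
      qed
      then show ?thesis
        by (auto intro: eventually_at_right_less eventually_mono)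
    next
      case False
      let ?f = "\<lambda>r. ((\<xi> + r *\<^sub>R v) \<bullet> snd t - b (fst t) (snd t)) - ((\<xi> + r *\<^sub>R v) \<bullet> a' - b (fst t) a')"
      have "(?f \<longlongrightarrow> ?f 0) (at_right 0)"
        by (intro tendsto_intros)
      moreover have "0 < ?f 0"
        using le False by simp
      ultimately have "\<forall>\<^sub>F r in at_right 0. 0 < ?f r"
        by (rule order_tendstoD)
      then show ?thesis
        by (rule eventually_mono) simp
    qed
  qed
  then obtain \<delta> where \<delta>: "0 < \<delta>" "\<And>r t a'. 0 < r \<Longrightarrow> r < \<delta> \<Longrightarrow> t \<in> R \<Longrightarrow> a' \<in> A (fst t) \<Longrightarrow>
      (\<xi> + r *\<^sub>R v) \<bullet> a' - b (fst t) a' \<le> (\<xi> + r *\<^sub>R v) \<bullet> snd t - b (fst t) (snd t)"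
    unfolding eventually_at_right_field by blast
  \<comment> \<open>Halving \<open>\<delta>\<close> makes the range of \<open>r\<close>
    closed.\<close>
  have "R \<subseteq> top_set A b s (\<xi> + r *\<^sub>R v)" if "0 \<le> r" "r \<le> \<delta> / 2" for r
  proof (cases "r = 0")
    case True
    then show ?thesis using R by simp
  next
    case False
    then have "0 < r" "r < \<delta>"
      using that \<delta>(1) by auto
    then show ?thesis
      using \<delta>(2) R by (fastforce simp: top_set_iff top_pts_def)
  qed
  then show thesis
    using \<delta>(1) by (intro that[of "\<delta> / 2"]) auto
qed

section \<open>The curve cut out on a generic flag\<close>

locale generic_curve =
  fixes A :: "nat \<Rightarrow> (real^'n) set" and b :: "nat \<Rightarrow> real^'n \<Rightarrow> real" and s :: nat
    and p :: "real^'n" and M :: "real^'n^'n" and d :: nat and k :: "nat \<Rightarrow> nat"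
  assumes A: "\<forall>i<s. finite (A i)"
    and s_le: "s \<le> CARD('n)"
    and gp: "lifting_general_position A b s"
    and gen: "generic_flag A b s p M"
    and d: "Suc d \<le> CARD('n)"
    and k_sum: "(\<Sum>i<s. k i) = d"
begin

abbreviation Top :: "real^'n \<Rightarrow> (nat \<times> (real^'n)) set" where
  "Top \<equiv> top_set A b s"

text \<open>Index shift: \<open>curve\<close> is \<open>X'_{d+1}\<close>, so the hyperplane to be met is \<open>F_d\<close>.\<close>

definition curve :: "(real^'n) set" where
  "curve = Xset A b s k (flag p M (Suc d))"

text \<open>Exactly \<open>k i + 1\<close> pairs of each colour, the least that puts a point of the
  flag on the curve. All tie data thus have \<open>s + d\<close> elements, one less than the number
  of columns over \<open>flag p M (Suc d)\<close>.\<close>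

definition tie_data :: "(nat \<times> (real^'n)) set set" where
  "tie_data = {T. T \<subseteq> Sigma {..<s} A \<and> (\<forall>i<s. card (T `` {i}) = Suc (k i))}"

definition piece :: "(nat \<times> (real^'n)) set \<Rightarrow> (real^'n) set" where
  "piece T = {\<xi> \<in> flag p M (Suc d). T \<subseteq> Top \<xi>}"

section \<open>Decomposition of the curve into pieces\<close>

lemma finite_Sigma_A: "finite (Sigma {..<s} A)"
  using A by auto

lemma finite_Top: "finite (Top \<xi>)"
  using finite_subset[OF top_set_subset finite_Sigma_A] .

lemma finite_top_pts: "i < s \<Longrightarrow> finite (top_pts A b i \<xi>)"
  using A by (auto simp: top_pts_def)

lemma card_Top: "card (Top \<xi>) = (\<Sum>i<s. card (top_pts A b i \<xi>))"
  unfolding top_set_def using finite_top_pts by (subst card_SigmaI) auto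

lemma curve_iff:
  "\<xi> \<in> curve \<longleftrightarrow> \<xi> \<in> flag p M (Suc d) \<and> (\<forall>i<s. Suc (k i) \<le> card (top_pts A b i \<xi>))"
  by (auto simp: curve_def Xset_def mult_at_def)

lemma curve_Top_cover:
  assumes "\<xi> \<in> curve"
  shows "fst ` Top \<xi> = {..<s}"
proof -
  have "top_pts A b i \<xi> \<noteq> {}" if "i < s" for i
    using assms that by (fastforce simp: curve_iff)
  then show ?thesis
    by (force simp: top_set_def image_iff)
qed

lemma tie_data_finite: "T \<in> tie_data \<Longrightarrow> finite T"
  unfolding tie_data_def using finite_subset[OF _ finite_Sigma_A] by blast

lemma tie_data_cover:
  assumes "T \<in> tie_data"
  shows "fst ` T = {..<s}"
proof
  show "fst ` T \<subseteq> {..<s}"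
    using assms by (auto simp: tie_data_def)
  show "{..<s} \<subseteq> fst ` T"
  proof
    fix i assume "i \<in> {..<s}"
    then have "card (T `` {i}) \<noteq> 0"
      using assms by (auto simp: tie_data_def)
    then obtain a where "(i, a) \<in> T"
      by (metis Image_singleton_iff card.empty equals0I)
    then show "i \<in> fst ` T"
      by force
  qed
qed

lemma tie_data_card:
  assumes T: "T \<in> tie_data"
  shows "card T = s + d"
proof -
  have "T = Sigma {..<s} (\<lambda>i. T `` {i})"
    using T by (auto simp: tie_data_def)
  then have "card T = card (Sigma {..<s} (\<lambda>i. T `` {i}))"
    by simp
  also have "\<dots> = (\<Sum>i<s. card (T `` {i}))"
    using tie_data_finite[OF T] by (intro card_SigmaI) auto
  also have "\<dots> = (\<Sum>i<s. Suc (k i))"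
    using T by (intro sum.cong) (auto simp: tie_data_def)
  also have "\<dots> = s + d"
    using k_sum by (simp add: sum_Suc)
  finally show ?thesis .
qed

lemma finite_tie_data: "finite tie_data"
  unfolding tie_data_def
  by (rule finite_subset[of _ "Pow (Sigma {..<s} A)"]) (use finite_Sigma_A in auto)

lemma piece_subset_curve:
  assumes "T \<in> tie_data"
  shows "piece T \<subseteq> curve"
proof
  fix \<xi> assume \<xi>: "\<xi> \<in> piece T"
  have "Suc (k i) \<le> card (top_pts A b i \<xi>)" if "i < s" for i
  proof -
    have "T `` {i} \<subseteq> top_pts A b i \<xi>"
      using \<xi> by (auto simp: piece_def top_set_def)
    then have "card (T `` {i}) \<le> card (top_pts A b i \<xi>)"
      by (rule card_mono[OF finite_top_pts[OF that]])
    then show ?thesis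
      using assms that by (simp add: tie_data_def)
  qed
  then show "\<xi> \<in> curve"
    using \<xi> by (simp add: curve_iff piece_def)
qed

lemma curve_eq_pieces: "curve = (\<Union>T\<in>tie_data. piece T)"
proof
  show "curve \<subseteq> (\<Union>T\<in>tie_data. piece T)"
  proof
    fix \<xi> assume \<xi>: "\<xi> \<in> curve"
    have "\<forall>i\<in>{..<s}. \<exists>B. B \<subseteq> top_pts A b i \<xi> \<and> card B = Suc (k i)"
    proof
      fix i assume "i \<in> {..<s}"
      then have "Suc (k i) \<le> card (top_pts A b i \<xi>)"
        using \<xi> by (simp add: curve_iff)
      then show "\<exists>B. B \<subseteq> top_pts A b i \<xi> \<and> card B = Suc (k i)"
        by (meson obtain_subset_with_card_n)
    qed
    then obtain B where B: "\<And>i. i < s \<Longrightarrow> B i \<subseteq> top_pts A b i \<xi>" "\<And>i. i < s \<Longrightarrow> card (B i) = Suc (k i)"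
      by (metis lessThan_iff)
    have sub: "Sigma {..<s} B \<subseteq> Top \<xi>"
      using B(1) by (auto simp: top_set_def)
    moreover have "Sigma {..<s} B `` {i} = B i" if "i < s" for i
      using that by auto
    ultimately have "Sigma {..<s} B \<in> tie_data"
      using B(2) top_set_subset[of A b s \<xi>] by (auto simp: tie_data_def)
    then show "\<xi> \<in> (\<Union>T\<in>tie_data. piece T)"
      using sub \<xi> by (auto simp: piece_def curve_iff)
  qed
  show "(\<Union>T\<in>tie_data. piece T) \<subseteq> curve"
    using piece_subset_curve by blast
qed

section \<open>What genericity says about ties and directions\<close>

lemma Top_aff_indep: "T \<subseteq> Top \<xi> \<Longrightarrow> aff_indep s T"
  by (rule lifting_general_position_top_aff_indep[OF gp s_le A])

lemma M_rows: "row_indep {..<CARD('n)} UNIV (\<lambda>j l. M $ idx j $ l)"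
  using gen by (simp add: generic_flag_def)

lemma M_combination_eq_0:
  assumes "(\<Sum>j<e. x j *\<^sub>R M $ idx j) = 0" "e \<le> CARD('n)" "j < e"
  shows "x j = 0"
proof -
  let ?y = "\<lambda>j. if j < e then x j else 0"
  have "(\<Sum>j<CARD('n). ?y j * M $ idx j $ l) = 0" for l
  proof -
    have "(\<Sum>j<CARD('n). ?y j * M $ idx j $ l) = (\<Sum>j<e. ?y j * M $ idx j $ l)"
      using assms(2) by (intro sum.mono_neutral_right) auto
    also have "\<dots> = (\<Sum>j<e. x j *\<^sub>R M $ idx j) $ l"
      by simp
    finally show ?thesis
      using assms(1) by simp
  qed
  then have "?y j = 0"
    using row_indepD[OF M_rows, of ?y j] assms(2,3) by simp
  then show ?thesis
    using assms(3) by simp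
qed

text \<open>The coordinates of \<open>\<xi>\<close> in the flag together with the maxima
  \<open>top_val\<close> form a column relation of the matrix of the second kind, and its
  coefficient at the lifting column is -1. With \<open>s + e + 1\<close> ties that matrix would have
  independent columns.\<close>

lemma card_Top_le:
  assumes \<xi>: "\<xi> \<in> flag p M e" and e: "e \<le> CARD('n)" and cover: "fst ` Top \<xi> = {..<s}"
  shows "card (Top \<xi>) \<le> s + e"
proof (rule ccontr)
  assume more: "\<not> card (Top \<xi>) \<le> s + e"
  \<comment> \<open>One tie of each colour is kept, so that the subset of size
    \<open>s + e + 1\<close> still shows every colour, as \<open>generic_flag\<close>
    demands.\<close>
  obtain g where g: "\<And>i. i < s \<Longrightarrow> g i \<in> Top \<xi> \<and> fst (g i) = i"
    using cover by (metis (no_types, lifting) image_iff lessThan_iff)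
  have "card (g ` {..<s}) \<le> s"
    using card_image_le[of "{..<s}" g] by simp
  moreover have "g ` {..<s} \<subseteq> Top \<xi>"
    using g by auto
  ultimately obtain T where T: "g ` {..<s} \<subseteq> T" "T \<subseteq> Top \<xi>" "card T = Suc (s + e)"
    using exists_subset_between[of "g ` {..<s}" "Suc (s + e)" "Top \<xi>"] more finite_Top by fastforce
  have "{..<s} \<subseteq> fst ` T"
    using T(1) g by force
  then have T_cover: "fst ` T = {..<s}"
    using T(2) cover by blast
  have finT: "finite T"
    using T(2) finite_Top finite_subset by blast
  define h where "h = (row_form M)(e := \<lambda>t. b (fst t) (snd t) - p \<bullet> snd t)"
  have "row_indep T (tie_cols s (Suc e)) (tie h)"
    using gen T T_cover e Top_aff_indep[OF T(2)] top_set_subset[of A b s \<xi>]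
    unfolding generic_flag_def h_def by blast
  then have ind: "row_indep (tie_cols s (Suc e)) T (\<lambda>k t. tie h t k)"
    using row_indep_square_transpose[OF finT, of "tie_cols s (Suc e)"] T(3) by (simp add: card_tie_cols)
  obtain c where c: "\<xi> = p + (\<Sum>j<e. c j *\<^sub>R M $ idx j)"
    using \<xi> flag_iff by blast
  define w where "w = (\<lambda>q. case q of Inl i \<Rightarrow> - top_val A b \<xi> i | Inr j \<Rightarrow> if j = e then - 1 else c j)"
  have "(\<Sum>q\<in>tie_cols s (Suc e). w q * tie h t q) = 0" if t: "t \<in> T" for t
  proof -
    have tt: "fst t < s" "snd t \<in> top_pts A b (fst t) \<xi>"
      using subsetD[OF T(2) t] by (auto simp: top_set_iff)
    have "(\<Sum>q\<in>tie_cols s (Suc e). w q * tie h t q) = w (Inl (fst t)) + (\<Sum>j<Suc e. w (Inr j) * h j t)"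
      using tt by (rule_tac sum_tie_cols)
    also have "\<dots> = - top_val A b \<xi> (fst t) + (\<Sum>j<e. c j * (M $ idx j \<bullet> snd t)) - (b (fst t) (snd t) - p \<bullet> snd t)"
      by (simp add: w_def h_def row_form_def)
    also have "(\<Sum>j<e. c j * (M $ idx j \<bullet> snd t)) = (\<xi> - p) \<bullet> snd t"
      by (simp add: c inner_sum_left)
    finally show ?thesis
      using top_val_eq[of A "fst t" "snd t" b \<xi>] A tt by (simp add: inner_diff_left)
  qed
  then have "w (Inr e) = 0"
    using row_indepD[OF ind, of w "Inr e"] by blast
  then show False
    by (simp add: w_def)
qed

text \<open>The coordinates of \<open>v\<close> and the negated slopes \<open>\<mu>\<close> form a
  column relation of a square nonsingular tie matrix.\<close>

lemma transversal:
  assumes T: "T \<subseteq> Top \<xi>" "fst ` T = {..<s}" "card T = s + e" and e: "e \<le> CARD('n)"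
    and v: "v \<in> row_span M e" and const: "\<And>t. t \<in> T \<Longrightarrow> snd t \<bullet> v = \<mu> (fst t)"
  shows "v = 0"
proof -
  have finT: "finite T"
    using T(1) finite_Top finite_subset by blast
  have "row_indep T (tie_cols s e) (tie (row_form M))"
    using gen T e Top_aff_indep[OF T(1)] top_set_subset[of A b s \<xi>]
    unfolding generic_flag_def by blast
  then have ind: "row_indep (tie_cols s e) T (\<lambda>k t. tie (row_form M) t k)"
    using row_indep_square_transpose[OF finT, of "tie_cols s e"] T(3) by (simp add: card_tie_cols)
  obtain c where c: "v = (\<Sum>j<e. c j *\<^sub>R M $ idx j)"
    using v row_span_iff by blast
  define w where "w = (\<lambda>q. case q of Inl i \<Rightarrow> - \<mu> i | Inr j \<Rightarrow> c j)"
  have "(\<Sum>q\<in>tie_cols s e. w q * tie (row_form M) t q) = 0" if t: "t \<in> T" for t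
  proof -
    have "fst t < s"
      using t T(2) by blast
    then have "(\<Sum>q\<in>tie_cols s e. w q * tie (row_form M) t q)
        = w (Inl (fst t)) + (\<Sum>j<e. w (Inr j) * row_form M j t)"
      by (rule sum_tie_cols)
    also have "\<dots> = - \<mu> (fst t) + v \<bullet> snd t"
      by (simp add: w_def row_form_def c inner_sum_left)
    finally show ?thesis
      using const[OF t] by (simp add: inner_commute)
  qed
  then have "c j = 0" if "j < e" for j
    using row_indepD[OF ind, of w "Inr j"] that by (simp add: w_def InrI)
  then show ?thesis
    by (simp add: c)
qed

text \<open>Fewer ties than columns leave a column relation, whose direction part is
  \<open>v\<close>. If \<open>v\<close> were 0, the colour part would vanish too, because every
  colour occurs in \<open>T\<close>.\<close>

lemma kernel_direction:
  assumes T: "finite T" "fst ` T = {..<s}" "card T < s + e" and e: "e \<le> CARD('n)"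
  obtains v \<mu> where "v \<in> row_span M e" "v \<noteq> 0" "\<And>t. t \<in> T \<Longrightarrow> snd t \<bullet> v = \<mu> (fst t)"
proof -
  obtain w q where q: "q \<in> tie_cols s e" "w q \<noteq> 0"
    and w: "\<And>t. t \<in> T \<Longrightarrow> (\<Sum>q\<in>tie_cols s e. w q * tie (row_form M) t q) = 0"
    using homogeneous_nontrivial_solution[of T "tie_cols s e" "tie (row_form M)"] T
    by (metis card_tie_cols finite_Plus finite_lessThan)
  define v where "v = (\<Sum>j<e. w (Inr j) *\<^sub>R M $ idx j)"
  have eq: "snd t \<bullet> v = - w (Inl (fst t))" if t: "t \<in> T" for t
  proof -
    have "fst t < s"
      using t T(2) by blast
    then have "w (Inl (fst t)) + (\<Sum>j<e. w (Inr j) * row_form M j t) = 0"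
      using w[OF t] by (simp add: sum_tie_cols)
    then show ?thesis
      by (simp add: v_def row_form_def inner_sum_right inner_commute)
  qed
  have "v \<noteq> 0"
  proof
    assume v0: "v = 0"
    have "w (Inr j) = 0" if "j < e" for j
      using M_combination_eq_0[of "\<lambda>j. w (Inr j)" e j] v0 e that by (simp add: v_def)
    moreover have "w (Inl i) = 0" if "i < s" for i
    proof -
      have "i \<in> fst ` T"
        using that T(2) by simp
      then obtain t where "t \<in> T" "fst t = i"
        by auto
      then show ?thesis
        using eq[of t] v0 by simp
    qed
    ultimately show False
      using q by auto
  qed
  moreover have "v \<in> row_span M e"
    unfolding row_span_iff v_def by (intro exI[of _ "\<lambda>j. w (Inr j)"] refl)
  ultimately show thesis
    using eq that[of v "\<lambda>i. - w (Inl i)"] by blast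
qed

section \<open>Functionals that separate consecutive flats\<close>

definition height :: "real^'n \<Rightarrow> bool" where
  "height u \<longleftrightarrow> (\<forall>j<d. u \<bullet> M $ idx j = 0) \<and> u \<bullet> M $ idx d \<noteq> 0"

text \<open>The rows of \<open>M\<close> form a basis, so there is a dual vector with value 1 on row
  \<open>d\<close> and 0 on the others.\<close>

lemma height_exists: obtains u where "height u"
proof -
  have "row_indep UNIV {..<CARD('n)} (\<lambda>l j. M $ idx j $ l)"
    by (rule row_indep_square_transpose[OF _ _ _ M_rows]) auto
  then obtain c where c: "\<And>j. j \<in> {..<CARD('n)} \<Longrightarrow> (\<Sum>l\<in>UNIV. c l * M $ idx j $ l) = of_bool (j = d)"
    by (rule row_indep_square_solve[OF finite finite_lessThan card_lessThan[symmetric], where \<psi>="\<lambda>j. of_bool (j = d)"])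
      (rule that)
  then have "(\<chi> l. c l) \<bullet> M $ idx j = of_bool (j = d)" if "j \<le> d" for j
    using that d by (simp add: inner_vec_def)
  then have "height (\<chi> l. c l)"
    by (simp add: height_def)
  then show thesis by (rule that)
qed

lemma height_uminus: "height u \<Longrightarrow> height (- u)"
  by (simp add: height_def)

lemma height_eq_0_iff:
  assumes u: "height u" and v: "v \<in> row_span M (Suc d)"
  shows "u \<bullet> v = 0 \<longleftrightarrow> v \<in> row_span M d"
proof
  obtain c where c: "v = (\<Sum>j<Suc d. c j *\<^sub>R M $ idx j)"
    using v row_span_iff by blast
  then have "u \<bullet> v = c d * (u \<bullet> M $ idx d)"
    using u by (simp add: height_def inner_add_right inner_sum_right)
  moreover assume "u \<bullet> v = 0"
  ultimately have "c d = 0"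
    using u by (simp add: height_def)
  then show "v \<in> row_span M d"
    using c row_span_iff by auto
next
  assume "v \<in> row_span M d"
  then show "u \<bullet> v = 0"
    using u unfolding row_span_iff by (auto simp: height_def inner_sum_right)
qed

lemma height_flag:
  assumes "height u" "\<xi> \<in> flag p M (Suc d)"
  shows "u \<bullet> \<xi> = u \<bullet> p \<longleftrightarrow> \<xi> \<in> flag p M d"
proof -
  have "p \<in> flag p M (Suc d)"
    unfolding flag_iff by (intro exI[of _ "\<lambda>_. 0"]) simp
  then have "\<xi> - p \<in> row_span M (Suc d)"
    using flag_diff assms(2) by blast
  then have "u \<bullet> (\<xi> - p) = 0 \<longleftrightarrow> \<xi> - p \<in> row_span M d"
    using height_eq_0_iff assms(1) by blast
  moreover have "\<xi> - p \<in> row_span M d \<longleftrightarrow> \<xi> \<in> flag p M d"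
    unfolding flag_def by (metis (no_types, lifting) add_diff_cancel_left' diff_add_cancel add.commute image_iff)
  ultimately show ?thesis
    by (simp add: inner_diff_right)
qed

text \<open>Otherwise \<open>v\<close> would be a direction of \<open>flag p M d\<close> along which
  all \<open>s + d\<close> ties persist, and the square tie matrix over that flat forbids
  this.\<close>

lemma tie_direction_height_nonzero:
  assumes T: "T \<in> tie_data" "T \<subseteq> Top \<xi>" and u: "height u"
    and v: "v \<in> row_span M (Suc d)" "v \<noteq> 0" and const: "\<And>t. t \<in> T \<Longrightarrow> snd t \<bullet> v = \<mu> (fst t)"
  shows "u \<bullet> v \<noteq> 0"
proof
  assume "u \<bullet> v = 0"
  then have "v \<in> row_span M d"
    using height_eq_0_iff[OF u v(1)] by simp
  then have "v = 0"
    using transversal[OF T(2) tie_data_cover[OF T(1)] tie_data_card[OF T(1)] _ _ const] d by auto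
  then show False
    using v(2) by simp
qed

text \<open>The difference of two points of a piece preserves the ties, and so does what remains
  after a multiple of \<open>w\<close> is subtracted. The multiple is chosen to make the height of
  the remainder 0, so the remainder vanishes.\<close>

lemma piece_in_line:
  assumes T: "T \<in> tie_data" and \<xi>: "\<xi> \<in> piece T" and \<eta>: "\<eta> \<in> piece T"
    and w: "w \<in> row_span M (Suc d)" "w \<noteq> 0" and const: "\<And>t. t \<in> T \<Longrightarrow> snd t \<bullet> w = \<mu> (fst t)"
  shows "\<exists>r. \<eta> = \<xi> + r *\<^sub>R w"
proof -
  obtain u where u: "height u"
    by (rule height_exists)
  have sub: "T \<subseteq> Top \<xi>" "T \<subseteq> Top \<eta>"
    using \<xi> \<eta> by (auto simp: piece_def)
  have uw: "u \<bullet> w \<noteq> 0"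
    by (rule tie_direction_height_nonzero[OF T sub(1) u w const])
  define r where "r = (u \<bullet> (\<eta> - \<xi>)) / (u \<bullet> w)"
  define v where "v = \<eta> - \<xi> - r *\<^sub>R w"
  have "\<eta> - \<xi> \<in> row_span M (Suc d)"
    using \<xi> \<eta> flag_diff by (auto simp: piece_def)
  then have v: "v \<in> row_span M (Suc d)"
    unfolding v_def using w(1) by (intro span_diff[of "\<eta> - \<xi>"] span_scale)
  have "snd t \<bullet> v = top_val A b \<eta> (fst t) - top_val A b \<xi> (fst t) - r * \<mu> (fst t)" if t: "t \<in> T" for t
  proof -
    have "t \<in> Top \<xi>" "t \<in> Top \<eta>"
      using sub t by auto
    then have "\<xi> \<bullet> snd t - b (fst t) (snd t) = top_val A b \<xi> (fst t)"
      "\<eta> \<bullet> snd t - b (fst t) (snd t) = top_val A b \<eta> (fst t)"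
      using A by (auto simp: top_set_iff intro!: top_val_eq)
    then show ?thesis
      using const[OF t] by (simp add: v_def inner_diff_right inner_commute)
  qed
  moreover have "u \<bullet> v = 0"
    using uw by (simp add: v_def r_def inner_diff_right)
  ultimately have "v = 0"
    using tie_direction_height_nonzero[OF T sub(1) u v,
        where \<mu>="\<lambda>i. top_val A b \<eta> i - top_val A b \<xi> i - r * \<mu> i"] by blast
  then have "\<eta> = \<xi> + r *\<^sub>R w"
    by (simp add: v_def algebra_simps)
  then show ?thesis
    by blast
qed

lemma move_in_piece:
  assumes \<xi>: "\<xi> \<in> piece T" and w: "w \<in> row_span M (Suc d)"
    and const: "\<And>t. t \<in> T \<Longrightarrow> snd t \<bullet> w = \<mu> (fst t)"
    and rest: "\<And>t. t \<in> Top \<xi> - T \<Longrightarrow> snd t \<bullet> w \<le> \<mu> (fst t)"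
  obtains \<epsilon> where "0 < \<epsilon>" "\<And>r. 0 \<le> r \<Longrightarrow> r \<le> \<epsilon> \<Longrightarrow> \<xi> + r *\<^sub>R w \<in> piece T"
proof -
  have "T \<subseteq> Top \<xi>"
    using \<xi> by (simp add: piece_def)
  moreover have "snd t' \<bullet> w \<le> snd t \<bullet> w" if "t \<in> T" "t' \<in> Top \<xi>" "fst t' = fst t" for t t'
    using that const[of t] const[of t'] rest[of t'] by (cases "t' \<in> T") auto
  ultimately obtain \<epsilon> where \<epsilon>: "0 < \<epsilon>" "\<And>r. 0 \<le> r \<Longrightarrow> r \<le> \<epsilon> \<Longrightarrow> T \<subseteq> Top (\<xi> + r *\<^sub>R w)"
    using top_set_stable[OF A] by metis
  show thesis
  proof (rule that[OF \<epsilon>(1)])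
    show "\<xi> + r *\<^sub>R w \<in> piece T" if "0 \<le> r" "r \<le> \<epsilon>" for r
      using \<epsilon>(2)[OF that] \<xi> w by (auto simp: piece_def intro: flag_add span_scale)
  qed
qed

section \<open>The shape of a piece\<close>

lemma card_Top_curve_le: "\<xi> \<in> curve \<Longrightarrow> card (Top \<xi>) \<le> s + Suc d"
  using card_Top_le[OF _ d curve_Top_cover] by (simp add: curve_iff)

text \<open>At most one maximal pair lies outside \<open>T\<close>, hence it can obstruct only one
  of the two directions along the piece.\<close>

lemma piece_direction:
  assumes T: "T \<in> tie_data" and \<xi>: "\<xi> \<in> piece T"
  obtains w \<mu> \<epsilon> where "w \<in> row_span M (Suc d)" "w \<noteq> 0" "\<And>t. t \<in> T \<Longrightarrow> snd t \<bullet> w = \<mu> (fst t)"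
    "0 < \<epsilon>" "\<xi> + \<epsilon> *\<^sub>R w \<in> piece T"
proof -
  obtain w \<mu> where w: "w \<in> row_span M (Suc d)" "w \<noteq> 0" "\<And>t. t \<in> T \<Longrightarrow> snd t \<bullet> w = \<mu> (fst t)"
    using kernel_direction[OF tie_data_finite[OF T] tie_data_cover[OF T] _ d] tie_data_card[OF T] by auto
  have sub: "T \<subseteq> Top \<xi>"
    using \<xi> by (simp add: piece_def)
  have "\<xi> \<in> curve"
    using piece_subset_curve[OF T] \<xi> by blast
  then have "card (Top \<xi> - T) \<le> 1"
    using card_Top_curve_le[of \<xi>] tie_data_card[OF T]
    by (subst card_Diff_subset[OF tie_data_finite[OF T] sub]) simp
  then have one: "t = t'" if "t \<in> Top \<xi> - T" "t' \<in> Top \<xi> - T" for t t'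
    using that finite_Top by (metis card_le_Suc0_iff_eq finite_Diff One_nat_def)
  show thesis
  proof (cases "\<forall>t\<in>Top \<xi> - T. snd t \<bullet> w \<le> \<mu> (fst t)")
    case True
    then obtain \<epsilon> where "0 < \<epsilon>" "\<And>r. 0 \<le> r \<Longrightarrow> r \<le> \<epsilon> \<Longrightarrow> \<xi> + r *\<^sub>R w \<in> piece T"
      using move_in_piece[OF \<xi> w(1) w(3)] by blast
    then show ?thesis
      using that[OF w] by simp
  next
    case False
    have w': "- w \<in> row_span M (Suc d)" "- w \<noteq> 0" "\<And>t. t \<in> T \<Longrightarrow> snd t \<bullet> (- w) = - \<mu> (fst t)"
      using w by (auto intro: span_neg)
    obtain t0 where t0: "t0 \<in> Top \<xi> - T" "\<mu> (fst t0) < snd t0 \<bullet> w"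
      using False by (meson not_le)
    have "snd t \<bullet> (- w) \<le> - \<mu> (fst t)" if "t \<in> Top \<xi> - T" for t
      using t0(2) one[OF that t0(1)] by simp
    then obtain \<epsilon> where \<epsilon>: "0 < \<epsilon>" "\<And>r. 0 \<le> r \<Longrightarrow> r \<le> \<epsilon> \<Longrightarrow> \<xi> + r *\<^sub>R (- w) \<in> piece T"
      using move_in_piece[OF \<xi> w'(1), of "\<lambda>i. - \<mu> i"] w'(3) by blast
    show ?thesis
      by (rule that[of "- w" "\<lambda>i. - \<mu> i" \<epsilon>]) (use w' \<epsilon>(1) \<epsilon>(2)[of \<epsilon>] in auto)
  qed
qed

text \<open>Maximality of the pairs in \<open>T\<close> is a finite system of linear inequalities in
  \<open>\<xi>\<close>, so a piece is a polyhedron.\<close>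

lemma closed_piece: "T \<in> tie_data \<Longrightarrow> closed (piece T)"
  and convex_piece: "T \<in> tie_data \<Longrightarrow> convex (piece T)"
proof -
  assume T: "T \<in> tie_data"
  have "piece T = flag p M (Suc d) \<inter>
      (\<Inter>t\<in>T. \<Inter>a\<in>A (fst t). {\<xi>. (a - snd t) \<bullet> \<xi> \<le> b (fst t) a - b (fst t) (snd t)})"
  proof -
    have "t \<in> Top \<xi> \<longleftrightarrow> (\<forall>a\<in>A (fst t). (a - snd t) \<bullet> \<xi> \<le> b (fst t) a - b (fst t) (snd t))"
      if "t \<in> T" for t \<xi>
    proof -
      have "t \<in> Sigma {..<s} A"
        using T that by (auto simp: tie_data_def)
      then have "fst t < s" "snd t \<in> A (fst t)"
        by auto
      moreover have "\<xi> \<bullet> a - b (fst t) a \<le> \<xi> \<bullet> snd t - b (fst t) (snd t) \<longleftrightarrow>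
          (a - snd t) \<bullet> \<xi> \<le> b (fst t) a - b (fst t) (snd t)" for a
        unfolding inner_diff_left inner_commute[of \<xi>] by linarith
      ultimately show ?thesis
        by (simp add: top_set_iff top_pts_def)
    qed
    then show ?thesis
      unfolding piece_def by blast
  qed
  then show "closed (piece T)" "convex (piece T)"
    by (auto intro!: closed_Int closed_INT convex_Int convex_INT closed_flag convex_flag
        closed_halfspace_le convex_halfspace_le)
qed

lemma piece_eq_Union:
  assumes T: "T \<in> tie_data"
  shows "\<exists>\<L>. finite \<L> \<and> (\<forall>L\<in>\<L>. seg_or_halfline L) \<and> piece T = \<Union>\<L>"
proof (cases "piece T = {}")
  case True
  then show ?thesis by (intro exI[of _ "{}"]) auto
next
  case False
  then obtain \<xi> where \<xi>: "\<xi> \<in> piece T"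
    by blast
  obtain w \<mu> \<epsilon> where w: "w \<in> row_span M (Suc d)" "w \<noteq> 0" "\<And>t. t \<in> T \<Longrightarrow> snd t \<bullet> w = \<mu> (fst t)"
    "0 < \<epsilon>" "\<xi> + \<epsilon> *\<^sub>R w \<in> piece T"
    using piece_direction[OF T \<xi>] by blast
  show ?thesis
    by (rule closed_convex_in_line_is_union[OF closed_piece[OF T] convex_piece[OF T] \<xi> w(2,4,5)])
      (rule piece_in_line[OF T \<xi> _ w(1-3)])
qed

lemma curve_eq_Union: "\<exists>\<L>. finite \<L> \<and> (\<forall>L\<in>\<L>. seg_or_halfline L) \<and> curve = \<Union>\<L>"
proof -
  obtain \<L> where "\<And>T. T \<in> tie_data \<Longrightarrow> finite (\<L> T)"
    "\<And>T L. T \<in> tie_data \<Longrightarrow> L \<in> \<L> T \<Longrightarrow> seg_or_halfline L"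
    "\<And>T. T \<in> tie_data \<Longrightarrow> piece T = \<Union>(\<L> T)"
    using piece_eq_Union by metis
  then show ?thesis
    using finite_tie_data by (intro exI[of _ "\<Union>T\<in>tie_data. \<L> T"]) (auto simp: curve_eq_pieces)
qed

lemma closed_curve: "closed curve"
  unfolding curve_eq_pieces using finite_tie_data closed_piece by (intro closed_UN) auto

text \<open>Each colour has at least \<open>k i + 1\<close> ties and these lower bounds already add
  up to \<open>s + d\<close>, so all of them are equalities.\<close>

lemma Top_tie_data:
  assumes "\<xi> \<in> curve" "card (Top \<xi>) \<le> s + d"
  shows "Top \<xi> \<in> tie_data"
proof -
  have ge: "Suc (k i) \<le> card (top_pts A b i \<xi>)" if "i < s" for i
    using assms(1) that by (simp add: curve_iff)
  have "(\<Sum>i<s. card (top_pts A b i \<xi>)) \<le> (\<Sum>i<s. Suc (k i))"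
    using assms(2) k_sum by (simp add: card_Top sum_Suc)
  then have "card (top_pts A b i \<xi>) = Suc (k i)" if "i < s" for i
    using sum_mono_inv[of "\<lambda>i. Suc (k i)" "{..<s}" "\<lambda>i. card (top_pts A b i \<xi>)" i] ge that
    by (metis (no_types, lifting) finite_lessThan lessThan_iff order_antisym sum_mono)
  moreover have "Top \<xi> `` {i} = top_pts A b i \<xi>" if "i < s" for i
    using that by (auto simp: top_set_def)
  ultimately show ?thesis
    using top_set_subset[of A b s \<xi>] by (auto simp: tie_data_def)
qed

section \<open>Descent along the curve\<close>

lemma descent_in_piece:
  assumes T: "T \<in> tie_data" and \<xi>: "\<xi> \<in> piece T" and w: "w \<in> row_span M (Suc d)"
    and const: "\<And>t. t \<in> T \<Longrightarrow> snd t \<bullet> w = \<mu> (fst t)"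
    and rest: "\<And>t. t \<in> Top \<xi> - T \<Longrightarrow> snd t \<bullet> w \<le> \<mu> (fst t)"
  shows "\<exists>\<epsilon>>0. \<forall>r. 0 \<le> r \<longrightarrow> r \<le> \<epsilon> \<longrightarrow> \<xi> + r *\<^sub>R w \<in> curve"
proof -
  obtain \<epsilon> where "0 < \<epsilon>" "\<And>r. 0 \<le> r \<Longrightarrow> r \<le> \<epsilon> \<Longrightarrow> \<xi> + r *\<^sub>R w \<in> piece T"
    using move_in_piece[OF \<xi> w const rest] by blast
  then show ?thesis
    using piece_subset_curve[OF T] by blast
qed

text \<open>With exactly \<open>s + d\<close> ties both directions along the piece are open and one
  of them lowers \<open>u\<close>. With one tie more, the tie to drop is selected by its multiplier,
  as in a pivot of the simplex method.\<close>

lemma descent: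
  assumes \<xi>: "\<xi> \<in> curve" and u: "height u"
  shows "\<exists>w. u \<bullet> w < 0 \<and> (\<exists>\<epsilon>>0. \<forall>r. 0 \<le> r \<longrightarrow> r \<le> \<epsilon> \<longrightarrow> \<xi> + r *\<^sub>R w \<in> curve)"
proof (cases "card (Top \<xi>) \<le> s + d")
  case True
  then have T: "Top \<xi> \<in> tie_data"
    using Top_tie_data \<xi> by blast
  have \<xi>T: "\<xi> \<in> piece (Top \<xi>)"
    using \<xi> by (simp add: piece_def curve_iff)
  obtain w \<mu> where w: "w \<in> row_span M (Suc d)" "w \<noteq> 0" "\<And>t. t \<in> Top \<xi> \<Longrightarrow> snd t \<bullet> w = \<mu> (fst t)"
    using kernel_direction[OF finite_Top tie_data_cover[OF T] _ d] tie_data_card[OF T] by auto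
  have nz: "u \<bullet> w \<noteq> 0"
    by (rule tie_direction_height_nonzero[OF T order_refl u w])
  show ?thesis
  proof (cases "u \<bullet> w < 0")
    case True
    then show ?thesis
      using descent_in_piece[OF T \<xi>T w(1) w(3)] by blast
  next
    case False
    then have "u \<bullet> (- w) < 0"
      using nz by simp
    moreover have "\<exists>\<epsilon>>0. \<forall>r. 0 \<le> r \<longrightarrow> r \<le> \<epsilon> \<longrightarrow> \<xi> + r *\<^sub>R (- w) \<in> curve"
      by (rule descent_in_piece[OF T \<xi>T, where \<mu>="\<lambda>i. - \<mu> i"]) (use w in \<open>auto intro: span_neg\<close>)
    ultimately show ?thesis by blast
  qed
next
  case False
  then have card: "card (Top \<xi>) = s + Suc d"
    using card_Top_curve_le[OF \<xi>] by simp
  \<comment> \<open>\<open>f i\<close> counts the ties of colour \<open>i\<close> beyond the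
    required \<open>k i + 1\<close>. In total there is one such tie, of colour \<open>j\<close>, so
    only ties of colour \<open>j\<close> may be dropped.\<close>
  define f where "f = (\<lambda>i. card (top_pts A b i \<xi>) - Suc (k i))"
  have f: "card (top_pts A b i \<xi>) = Suc (k i) + f i" if "i < s" for i
    using \<xi> that unfolding f_def curve_iff by (metis le_add_diff_inverse)
  have "(\<Sum>i<s. card (top_pts A b i \<xi>)) = (\<Sum>i<s. Suc (k i) + f i)"
    using f by simp
  then have f_sum: "(\<Sum>i<s. f i) = 1"
    using card k_sum by (simp add: card_Top sum_Suc sum.distrib)
  then obtain j where j: "j < s" "f j \<noteq> 0"
    by (metis lessThan_iff sum.neutral zero_neq_one)
  have fj: "f j = 1" "\<And>i. i < s \<Longrightarrow> i \<noteq> j \<Longrightarrow> f i = 0"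
  proof -
    have "f j + (\<Sum>i\<in>{..<s} - {j}. f i) = 1"
      using f_sum j by (simp add: sum.remove[of "{..<s}" j])
    then have "f j = 1" "(\<Sum>i\<in>{..<s} - {j}. f i) = 0"
      using j(2) by linarith+
    then show "f j = 1" "\<And>i. i < s \<Longrightarrow> i \<noteq> j \<Longrightarrow> f i = 0"
      by (simp_all add: sum_eq_0_iff)
  qed
  have flag: "\<xi> \<in> flag p M (Suc d)"
    using \<xi> by (simp add: curve_iff)
  have drop: "Top \<xi> - {(j, a)} \<in> tie_data" if a: "a \<in> top_pts A b j \<xi>" for a
  proof -
    have "card ((Top \<xi> - {(j, a)}) `` {i}) = Suc (k i)" if i: "i < s" for i
    proof (cases "i = j")
      case True
      have "(Top \<xi> - {(j, a)}) `` {j} = top_pts A b j \<xi> - {a}"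
        using j by (auto simp: top_set_def)
      then show ?thesis
        using a f[OF j(1)] fj(1) finite_top_pts[OF j(1)] True by simp
    next
      case False
      then have "(Top \<xi> - {(j, a)}) `` {i} = top_pts A b i \<xi>"
        using i by (auto simp: top_set_def)
      then show ?thesis
        using f[OF i] fj(2)[OF i False] by simp
    qed
    then show ?thesis
      using top_set_subset[of A b s \<xi>] by (auto simp: tie_data_def)
  qed
  have "card (Top \<xi>) = card (tie_cols s (Suc d))"
    by (simp only: card card_tie_cols)
  moreover have "row_indep (Top \<xi>) (tie_cols s (Suc d)) (tie (row_form M))"
    using gen card d curve_Top_cover[OF \<xi>] Top_aff_indep[OF order_refl] top_set_subset[of A b s \<xi>]
    unfolding generic_flag_def by blast
  \<comment> \<open>The tie matrix is square with independent rows, so the colour columns can be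
    given the value 0 and the direction columns the values of \<open>u\<close>.\<close>
  ultimately obtain c where c: "\<And>q. q \<in> tie_cols s (Suc d) \<Longrightarrow> (\<Sum>t\<in>Top \<xi>. c t * tie (row_form M) t q)
      = (case q of Inl i \<Rightarrow> 0 | Inr l \<Rightarrow> u \<bullet> M $ idx l)"
    by (rule row_indep_square_solve[OF finite_Top finite_Plus[OF finite_lessThan finite_lessThan],
          where \<psi>="\<lambda>q. case q of Inl i \<Rightarrow> 0 | Inr l \<Rightarrow> u \<bullet> M $ idx l"]) (rule that)
  have c_fibre: "(\<Sum>t\<in>Top \<xi>. c t * of_bool (fst t = i)) = 0" if "i < s" for i
    using c[OF InlI, of i] that by simp
  have c_height: "u \<bullet> v = (\<Sum>t\<in>Top \<xi>. c t * (snd t \<bullet> v))" if v: "v \<in> row_span M (Suc d)" for v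
  proof -
    obtain x where x: "v = (\<Sum>l<Suc d. x l *\<^sub>R M $ idx l)"
      using v row_span_iff by blast
    have "u \<bullet> v = (\<Sum>l<Suc d. x l * (u \<bullet> M $ idx l))"
      unfolding x by (simp only: inner_sum_right inner_scaleR_right)
    also have "\<dots> = (\<Sum>l<Suc d. x l * (\<Sum>t\<in>Top \<xi>. c t * (snd t \<bullet> M $ idx l)))"
    proof (intro sum.cong refl)
      fix l assume "l \<in> {..<Suc d}"
      then show "x l * (u \<bullet> M $ idx l) = x l * (\<Sum>t\<in>Top \<xi>. c t * (snd t \<bullet> M $ idx l))"
        using c[OF InrI, of l] by (simp add: row_form_def inner_commute)
    qed
    also have "\<dots> = (\<Sum>t\<in>Top \<xi>. c t * (snd t \<bullet> v))"
      unfolding x sum_distrib_left inner_sum_right inner_scaleR_right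
      by (subst sum.swap) (simp only: mult_ac)
    finally show ?thesis .
  qed
  have dir: "\<exists>w \<mu>. w \<in> row_span M (Suc d) \<and> (\<forall>t\<in>Top \<xi> - {(j, a)}. snd t \<bullet> w = \<mu> (fst t)) \<and>
      u \<bullet> w \<noteq> 0 \<and> u \<bullet> w = c (j, a) * (a \<bullet> w - \<mu> j)" if a: "a \<in> top_pts A b j \<xi>" for a
  proof -
    let ?T = "Top \<xi> - {(j, a)}"
    note T = drop[OF a]
    obtain w \<mu> where w: "w \<in> row_span M (Suc d)" "w \<noteq> 0" "\<And>t. t \<in> ?T \<Longrightarrow> snd t \<bullet> w = \<mu> (fst t)"
      using kernel_direction[OF tie_data_finite[OF T] tie_data_cover[OF T] _ d] tie_data_card[OF T] by auto
    have "u \<bullet> w \<noteq> 0"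
      by (rule tie_direction_height_nonzero[OF T _ u w]) auto
    moreover have "u \<bullet> w = c (j, a) * (a \<bullet> w - \<mu> j)"
    proof -
      have ja: "(j, a) \<in> Top \<xi>"
        using a j by (simp add: top_set_iff)
      \<comment> \<open>The multipliers add up to 0 over each colour, so the common slopes can be
        subtracted for free; afterwards only the dropped tie contributes.\<close>
      have \<mu>: "(\<Sum>t\<in>Top \<xi>. c t * \<mu> (fst t)) = 0"
      proof -
        have "c t * \<mu> (fst t) = (\<Sum>i<s. c t * of_bool (fst t = i) * \<mu> i)" if "t \<in> Top \<xi>" for t
        proof -
          have "(\<Sum>i<s. c t * of_bool (fst t = i) * \<mu> i) = (\<Sum>i<s. if i = fst t then c t * \<mu> i else 0)"
            by (intro sum.cong) auto
          then show ?thesis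
            using that by (simp add: top_set_iff)
        qed
        then have "(\<Sum>t\<in>Top \<xi>. c t * \<mu> (fst t)) = (\<Sum>t\<in>Top \<xi>. \<Sum>i<s. c t * of_bool (fst t = i) * \<mu> i)"
          by (intro sum.cong refl)
        also have "\<dots> = (\<Sum>i<s. (\<Sum>t\<in>Top \<xi>. c t * of_bool (fst t = i)) * \<mu> i)"
          by (subst sum.swap) (simp add: sum_distrib_right)
        finally show ?thesis
          using c_fibre by simp
      qed
      have "u \<bullet> w = (\<Sum>t\<in>Top \<xi>. c t * (snd t \<bullet> w)) - (\<Sum>t\<in>Top \<xi>. c t * \<mu> (fst t))"
        using c_height[OF w(1)] \<mu> by simp
      also have "\<dots> = (\<Sum>t\<in>Top \<xi>. c t * (snd t \<bullet> w - \<mu> (fst t)))"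
        by (simp add: right_diff_distrib sum_subtractf)
      also have "\<dots> = c (j, a) * (a \<bullet> w - \<mu> j) + (\<Sum>t\<in>?T. c t * (snd t \<bullet> w - \<mu> (fst t)))"
        using ja finite_Top by (simp add: sum.remove)
      also have "(\<Sum>t\<in>?T. c t * (snd t \<bullet> w - \<mu> (fst t))) = 0"
        using w(3) by (intro sum.neutral) simp
      finally show ?thesis by simp
    qed
    ultimately show ?thesis
      using w by blast
  qed
  \<comment> \<open>If none were positive, the sum 0 over colour \<open>j\<close> would make them
    all vanish, whereas \<open>dir\<close> shows \<open>u \<bullet> w\<close> to be a nonzero
    multiple of \<open>c (j, a)\<close>.\<close>
  have "\<exists>a\<in>top_pts A b j \<xi>. 0 < c (j, a)"
  proof (rule ccontr)
    assume "\<not> ?thesis"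
    then have np: "c (j, a) \<le> 0" if "a \<in> top_pts A b j \<xi>" for a
      using that by (meson not_le)
    have "top_pts A b j \<xi> \<noteq> {}"
      using f[OF j(1)] by auto
    then obtain a where a: "a \<in> top_pts A b j \<xi>"
      by blast
    have "0 \<le> - (c t * of_bool (fst t = j))" if "t \<in> Top \<xi>" for t
      using that np[of "snd t"] by (cases t) (auto simp: top_set_def)
    moreover have "(\<Sum>t\<in>Top \<xi>. - (c t * of_bool (fst t = j))) = 0"
      unfolding sum_negf using c_fibre[OF j(1)] by simp
    ultimately have "\<forall>t\<in>Top \<xi>. - (c t * of_bool (fst t = j)) = 0"
      using finite_Top by (subst (asm) sum_nonneg_eq_0_iff) auto
    moreover have "(j, a) \<in> Top \<xi>"
      using a j(1) by (simp add: top_set_def)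
    ultimately have "c (j, a) = 0"
      by fastforce
    then show False
      using dir[OF a] by auto
  qed
  then obtain a where a: "a \<in> top_pts A b j \<xi>" "0 < c (j, a)"
    by blast
  obtain w \<mu> where w: "w \<in> row_span M (Suc d)" "\<And>t. t \<in> Top \<xi> - {(j, a)} \<Longrightarrow> snd t \<bullet> w = \<mu> (fst t)"
    "u \<bullet> w \<noteq> 0" "u \<bullet> w = c (j, a) * (a \<bullet> w - \<mu> j)"
    using dir[OF a(1)] by blast
  note T = drop[OF a(1)]
  have \<xi>T: "\<xi> \<in> piece (Top \<xi> - {(j, a)})"
    using flag by (auto simp: piece_def)
  \<comment> \<open>Since \<open>c (j, a)\<close> is positive, \<open>u \<bullet> w\<close> and the
    relative slope \<open>a \<bullet> w - \<mu> j\<close> have the same sign. Along the direction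
    that lowers \<open>u\<close> the dropped tie thus falls below the others of its colour and does
    not leave the piece blocked.\<close>
  show ?thesis
  proof (cases "u \<bullet> w < 0")
    case True
    then have "a \<bullet> w < \<mu> j"
      using w(4) a(2) by (simp add: mult_less_0_iff)
    then have "\<exists>\<epsilon>>0. \<forall>r. 0 \<le> r \<longrightarrow> r \<le> \<epsilon> \<longrightarrow> \<xi> + r *\<^sub>R w \<in> curve"
      by (intro descent_in_piece[OF T \<xi>T w(1) w(2)]) auto
    then show ?thesis
      using True by blast
  next
    case False
    then have neg: "u \<bullet> (- w) < 0"
      using w(3) by simp
    then have "\<mu> j < a \<bullet> w"
      using w(4) a(2) by (simp add: zero_less_mult_iff)
    then have "\<exists>\<epsilon>>0. \<forall>r. 0 \<le> r \<longrightarrow> r \<le> \<epsilon> \<longrightarrow> \<xi> + r *\<^sub>R (- w) \<in> curve"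
      using w by (intro descent_in_piece[OF T \<xi>T, where \<mu>="\<lambda>i. - \<mu> i"]) (auto intro: span_neg)
    then show ?thesis
      using neg by blast
  qed
qed

section \<open>Connected components and transversality\<close>

lemma component_meets_flag:
  assumes C: "C \<in> components curve"
  shows "C \<inter> flag p M d \<noteq> {}"
proof
  assume empty: "C \<inter> flag p M d = {}"
  have C_sub: "C \<subseteq> curve" and C_conn: "connected C" and C_ne: "C \<noteq> {}"
    using in_components_subset[OF C] in_components_connected[OF C] in_components_nonempty[OF C] .
  have C_max: "D \<subseteq> C" if "connected D" "D \<subseteq> curve" "D \<inter> C \<noteq> {}" for D
    using components_maximal[OF C that(1,2)] that(3) by blast
  obtain u0 where u0: "height u0"
    by (rule height_exists)
  have ne: "u0 \<bullet> x \<noteq> u0 \<bullet> p" if "x \<in> C" for x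
  proof -
    have "x \<in> flag p M (Suc d)" "x \<notin> flag p M d"
      using that C_sub empty curve_iff by blast+
    then show ?thesis
      using height_flag[OF u0] by blast
  qed
  \<comment> \<open>On the connected set \<open>C\<close> the functional \<open>u0\<close> never
    takes the value \<open>u0 \<bullet> p\<close>, so it stays on one side of it; the sign of
    \<open>u\<close> makes this a lower bound.\<close>
  obtain u where u: "height u" and pos: "\<And>x. x \<in> C \<Longrightarrow> u \<bullet> p \<le> u \<bullet> x"
  proof (cases "\<forall>x\<in>C. u0 \<bullet> p \<le> u0 \<bullet> x")
    case True
    then show ?thesis using that u0 by blast
  next
    case False
    then obtain x where x: "x \<in> C" "u0 \<bullet> x < u0 \<bullet> p"
      by force
    have "(- u0) \<bullet> p \<le> (- u0) \<bullet> y" if "y \<in> C" for y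
    proof (rule ccontr)
      assume "\<not> (- u0) \<bullet> p \<le> (- u0) \<bullet> y"
      then have "u0 \<bullet> p \<le> u0 \<bullet> y"
        by simp
      then obtain z where "z \<in> C" "u0 \<bullet> z = u0 \<bullet> p"
        using connected_ivt_hyperplane[OF C_conn x(1) \<open>y \<in> C\<close>, of u0 "u0 \<bullet> p"] x(2) by auto
      then show False
        using ne by blast
    qed
    then show ?thesis
      using that[OF height_uminus[OF u0]] by blast
  qed
  obtain \<L> where \<L>: "finite \<L>" "\<And>L. L \<in> \<L> \<Longrightarrow> seg_or_halfline L" "curve = \<Union>\<L>"
    using curve_eq_Union by blast
  define \<L>C where "\<L>C = {L \<in> \<L>. L \<inter> C \<noteq> {}}"
  have \<L>C_sub: "L \<subseteq> C" if "L \<in> \<L>C" for L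
    using that \<L> by (intro C_max seg_or_halfline_connected) (auto simp: \<L>C_def)
  \<comment> \<open>A minimum exists although \<open>C\<close> may be unbounded: each of the
    finitely many segments and half-lines that make up \<open>C\<close> attains its own.\<close>
  have "\<forall>L\<in>\<L>C. \<exists>x\<in>L. \<forall>y\<in>L. u \<bullet> x \<le> u \<bullet> y"
  proof
    fix L assume L: "L \<in> \<L>C"
    then have "seg_or_halfline L"
      using \<L> by (simp add: \<L>C_def)
    then obtain x where "x \<in> L" "\<And>y. y \<in> L \<Longrightarrow> u \<bullet> x \<le> u \<bullet> y"
      using seg_or_halfline_inner_attains_min[of L "u \<bullet> p" u] pos \<L>C_sub[OF L] by blast
    then show "\<exists>x\<in>L. \<forall>y\<in>L. u \<bullet> x \<le> u \<bullet> y"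
      by blast
  qed
  then obtain m where m: "\<And>L. L \<in> \<L>C \<Longrightarrow> m L \<in> L" "\<And>L y. L \<in> \<L>C \<Longrightarrow> y \<in> L \<Longrightarrow> u \<bullet> m L \<le> u \<bullet> y"
    by metis
  have cover: "\<exists>L\<in>\<L>C. x \<in> L" if "x \<in> C" for x
    using that C_sub \<L>(3) unfolding \<L>C_def by blast
  have "finite \<L>C" "\<L>C \<noteq> {}"
    using \<L>(1) C_ne cover by (auto simp: \<L>C_def)
  then obtain L0 where L0: "L0 \<in> \<L>C" "\<And>L. L \<in> \<L>C \<Longrightarrow> u \<bullet> m L0 \<le> u \<bullet> m L"
    using arg_min_if_finite[of \<L>C "\<lambda>L. u \<bullet> m L"] by (metis not_le)
  define \<xi> where "\<xi> = m L0"
  have \<xi>C: "\<xi> \<in> C"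
    using m(1)[OF L0(1)] \<L>C_sub[OF L0(1)] by (auto simp: \<xi>_def)
  have min: "u \<bullet> \<xi> \<le> u \<bullet> y" if "y \<in> C" for y
    using cover[OF that] L0(2) m(2) order_trans unfolding \<xi>_def by blast
  obtain w \<epsilon> where w: "u \<bullet> w < 0" and \<epsilon>: "0 < \<epsilon>" "\<And>r. 0 \<le> r \<Longrightarrow> r \<le> \<epsilon> \<Longrightarrow> \<xi> + r *\<^sub>R w \<in> curve"
    using descent[OF _ u] \<xi>C C_sub by blast
  \<comment> \<open>The short descent is connected and starts in \<open>C\<close>, so it stays in
    the component and contradicts minimality.\<close>
  let ?D = "(\<lambda>r. \<xi> + r *\<^sub>R w) ` {0..\<epsilon>}"
  have "?D \<subseteq> C"
  proof (rule C_max)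
    show "connected ?D"
      by (intro connected_continuous_image continuous_intros connected_Icc)
    show "?D \<subseteq> curve"
      using \<epsilon> by auto
    have "\<xi> \<in> ?D"
      using \<epsilon>(1) by (intro image_eqI[of _ _ 0]) auto
    then show "?D \<inter> C \<noteq> {}"
      using \<xi>C by blast
  qed
  moreover have "\<xi> + \<epsilon> *\<^sub>R w \<in> ?D"
    using \<epsilon>(1) by (intro imageI) simp
  ultimately have "\<xi> + \<epsilon> *\<^sub>R w \<in> C"
    by blast
  then have "0 \<le> \<epsilon> * (u \<bullet> w)"
    using min by (force simp: inner_add_right)
  then show False
    using w \<epsilon>(1) by (simp add: zero_le_mult_iff)
qed

text \<open>On \<open>flag p M d\<close> there is no tie beyond the \<open>s + d\<close> of the tie
  datum, so neither direction along the piece is obstructed and a segment with midpoint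
  \<open>\<xi>\<close> fits into it.\<close>

lemma transversal_segment:
  assumes \<xi>: "\<xi> \<in> curve \<inter> flag p M d"
  shows "\<exists>L. seg_or_halfline L \<and> L \<subseteq> curve \<and> \<xi> \<in> rel_interior L"
proof -
  have "card (Top \<xi>) \<le> s + d"
    using card_Top_le[of \<xi> d] \<xi> curve_Top_cover d by auto
  then have T: "Top \<xi> \<in> tie_data"
    using Top_tie_data \<xi> by blast
  have \<xi>T: "\<xi> \<in> piece (Top \<xi>)"
    using \<xi> by (simp add: piece_def curve_iff)
  obtain w \<mu> where w: "w \<in> row_span M (Suc d)" "w \<noteq> 0" "\<And>t. t \<in> Top \<xi> \<Longrightarrow> snd t \<bullet> w = \<mu> (fst t)"
    using kernel_direction[OF finite_Top tie_data_cover[OF T] _ d] tie_data_card[OF T] by auto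
  obtain \<epsilon>1 where \<epsilon>1: "0 < \<epsilon>1" "\<And>r. 0 \<le> r \<Longrightarrow> r \<le> \<epsilon>1 \<Longrightarrow> \<xi> + r *\<^sub>R w \<in> piece (Top \<xi>)"
    using move_in_piece[OF \<xi>T w(1) w(3)] by blast
  have w': "- w \<in> row_span M (Suc d)" "\<And>t. t \<in> Top \<xi> \<Longrightarrow> snd t \<bullet> (- w) = - \<mu> (fst t)"
    using w by (auto intro: span_neg)
  obtain \<epsilon>2 where \<epsilon>2: "0 < \<epsilon>2" "\<And>r. 0 \<le> r \<Longrightarrow> r \<le> \<epsilon>2 \<Longrightarrow> \<xi> + r *\<^sub>R (- w) \<in> piece (Top \<xi>)"
    using move_in_piece[OF \<xi>T w'(1), of "\<lambda>i. - \<mu> i"] w'(2) by blast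
  define \<epsilon> where "\<epsilon> = min \<epsilon>1 \<epsilon>2"
  have \<epsilon>: "0 < \<epsilon>" "\<epsilon> \<le> \<epsilon>1" "\<epsilon> \<le> \<epsilon>2"
    using \<epsilon>1 \<epsilon>2 by (auto simp: \<epsilon>_def)
  let ?x = "\<xi> + \<epsilon> *\<^sub>R w" and ?y = "\<xi> + \<epsilon> *\<^sub>R (- w)"
  have "closed_segment ?x ?y \<subseteq> piece (Top \<xi>)"
    using \<epsilon>1(2)[of \<epsilon>] \<epsilon>2(2)[of \<epsilon>] \<epsilon> by (intro closed_segment_subset convex_piece T) auto
  then have sub: "closed_segment ?x ?y \<subseteq> curve"
    using piece_subset_curve[OF T] by blast
  have "?x - ?y = (2 * \<epsilon>) *\<^sub>R w"
    by (simp add: algebra_simps flip: scaleR_2)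
  then have ne: "?x \<noteq> ?y"
    using \<epsilon>(1) w(2) by (metis eq_iff_diff_eq_0 mult_pos_pos order_less_irrefl scaleR_eq_0_iff zero_less_numeral)
  have "midpoint ?x ?y = \<xi>"
    by (simp add: midpoint_def algebra_simps flip: scaleR_2)
  then have "\<xi> \<in> rel_interior (closed_segment ?x ?y)"
    using ne midpoint_in_open_segment[of ?x ?y] by (simp add: rel_interior_closed_segment)
  then show ?thesis
    using sub ne unfolding seg_or_halfline_def by blast
qed

end

theorem theorem2p3:
  fixes A :: "nat \<Rightarrow> (real^'n) set" and m :: "nat \<Rightarrow> nat" and s :: nat
    and b :: "nat \<Rightarrow> real^'n \<Rightarrow> real" and md :: "nat \<Rightarrow> nat \<Rightarrow> nat"
  assumes s_range: "1 \<le> s" "s \<le> CARD('n)"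
    and A_fin: "\<forall>i<s. finite (A i)"
    and A_int: "\<forall>i<s. \<forall>a\<in>A i. \<forall>j. a $ j \<in> \<int>"
    and m_sum: "(\<Sum>i<s. m i) = CARD('n)"
    and mv: "mixed_volume_mult (\<lambda>i. convex hull (A i)) m s \<ge> 1"
    and gp: "lifting_general_position A b s"
    and md_seq: "\<forall>i<s. md i 0 = 0 \<and> md i CARD('n) = m i \<and> (\<forall>d<CARD('n). md i d \<le> md i (Suc d))"
    and md_sum: "\<forall>d\<le>CARD('n). (\<Sum>i<s. md i d) = d"
  shows "\<exists>U :: ((real^'n) \<times> (real^'n^'n)) set. open U \<and> negligible (- U) \<and>
    (\<forall>p M. (p, M) \<in> U \<longrightarrow>
      (\<forall>d \<in> {1..CARD('n)}.
        (let F = flag p M;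
             X = (\<lambda>k. Xset A b s (\<lambda>i. md i k) (F k));
             X' = Xset A b s (\<lambda>i. md i (d - 1)) (F d)
         in
           \<comment> \<open>(a)\<close>
           (closed X' \<and> (\<exists>\<L>. finite \<L> \<and> (\<forall>L\<in>\<L>. seg_or_halfline L) \<and> X' = \<Union>\<L>)) \<and>
           \<comment> \<open>(b)\<close>
           X (d - 1) = X' \<inter> F (d - 1) \<and>
           \<comment> \<open>(c)\<close>
           (\<forall>C \<in> components X'. C \<inter> F (d - 1) \<noteq> {}) \<and>
           \<comment> \<open>(d)\<close>
           (\<forall>\<xi> \<in> X' \<inter> F (d - 1). \<exists>L. seg_or_halfline L \<and> L \<subseteq> X' \<and> \<xi> \<in> rel_interior L))))"
proof -
  obtain U :: "((real^'n) \<times> (real^'n^'n)) set" where U: "open U" "negligible (- U)"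
    and gen: "\<And>p M. (p, M) \<in> U \<Longrightarrow> generic_flag A b s p M"
    using generically_generic_flag[OF A_fin, of b] unfolding generically_def by fast
  show ?thesis
  proof (intro exI[of _ U] conjI U allI impI ballI)
    fix p M d
    assume pM: "(p, M) \<in> U" and d_range: "d \<in> {1..CARD('n)}"
    interpret generic_curve A b s p M "d - 1" "\<lambda>i. md i (d - 1)"
      using d_range s_range gen[OF pM] md_sum gp A_fin by unfold_locales auto
    have curve: "Xset A b s (\<lambda>i. md i (d - 1)) (flag p M d) = curve"
      unfolding curve_def using d_range by simp
    \<comment> \<open>This is part (b): both sides ask for the multiplicities
      \<open>md i (d - 1)\<close> and differ only in the flat.\<close>
    have "Xset A b s (\<lambda>i. md i (d - 1)) (flag p M (d - 1)) = curve \<inter> flag p M (d - 1)"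
      using flag_mono[of "d - 1" d p M] unfolding curve[symmetric] by (auto simp: Xset_def)
    then show "let F = flag p M;
             X = (\<lambda>k. Xset A b s (\<lambda>i. md i k) (F k));
             X' = Xset A b s (\<lambda>i. md i (d - 1)) (F d)
         in (closed X' \<and> (\<exists>\<L>. finite \<L> \<and> (\<forall>L\<in>\<L>. seg_or_halfline L) \<and> X' = \<Union>\<L>)) \<and>
           X (d - 1) = X' \<inter> F (d - 1) \<and>
           (\<forall>C \<in> components X'. C \<inter> F (d - 1) \<noteq> {}) \<and>
           (\<forall>\<xi> \<in> X' \<inter> F (d - 1). \<exists>L. seg_or_halfline L \<and> L \<subseteq> X' \<and> \<xi> \<in> rel_interior L)"
      unfolding Let_def curve
      using closed_curve curve_eq_Union component_meets_flag transversal_segment by blast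
  qed
qed

end
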